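(* Let $G$ be a distributed system over a finite directed graph $\mathcal{G}(V,E)$ given by a balanced realization with balanced generalized gramians $\Sigma^{(k)}(t)=\mathrm{diag}(\Gamma^{(k)}(t),\Omega^{(k)}(t))$ and $\Sigma^{(ij)}(t)=\mathrm{diag}(\Gamma^{(ij)}(t),\Omega^{(ij)}(t))$, and let $G_r$ be the reduced order system obtained by balanced truncation of the states corresponding to the blocks $\Omega^{(k)}(t)$, $\Omega^{(ij)}(t)$. Let $\Omega$ be the (possibly infinite dimensional) block-diagonal matrix whose diagonal blocks are all the $\Omega^{(k)}(t)$, $(t,k)\in\mathbb{N}_0\times V$, and all the $\Omega^{(ij)}(t)$, $t\in\mathbb{N}_0$, $(i,j)\in E$ (blocks of dimension zero being omitted). Then the error system $G-G_r$ resulting from balanced truncation satisfies $$\|G-G_r\|<2\,\zeta(\Omega),$$ where $\zeta(X)$ denotes the sum of the distinct diagonal entries of a square, possibly infinite dimensional, matrix $X$.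
   Context: **Systems.** $\mathcal{G}(V,E)$ is a finite directed graph with $V=\{1,\dots,N\}$. For $k\in V$, $E_{\mathrm{in}}^{(k)}=\{i\in V\mid (i,k)\in E\}$ and $E_{\mathrm{out}}^{(k)}=\{j\in V\mid (k,j)\in E\}$, both ordered increasingly. A distributed system $G$ has, for each $k\in V$ and $t\in\mathbb{N}_0$, a temporal state $x^{(k)}(t)\in\mathbb{R}^{n^{(k)}(t)}$, input $u^{(k)}(t)\in\mathbb{R}^{n_u^{(k)}(t)}$, output $y^{(k)}(t)\in\mathbb{R}^{n_y^{(k)}(t)}$, and for each edge $(i,j)\in E$ a spatial state $x^{(ij)}(t)\in\mathbb{R}^{n^{(ij)}(t)}$ (all dimensions may vary with time and may be zero). Let $x_{\mathrm{in}}^{(k)}(t)$ be the vertical concatenation of $x^{(ik)}(t)$, $i\in E_{\mathrm{in}}^{(k)}$, and $x_{\mathrm{out}}^{(k)}(t)$ the vertical concatenation of $x^{(kj)}(t)$, $j\in E_{\mathrm{out}}^{(k)}$. The dynamics are, with $x^{(k)}(0)=0$, $x_{\mathrm{in}}^{(k)}(0)=0$, for all $(t,k)\in\mathbb{N}_0\times V$, $$\begin{bmatrix} x^{(k)}(t+1) \\ x_{\mathrm{out}}^{(k)}(t+1)\end{bmatrix}=A^{(k)}(t)\begin{bmatrix} x^{(k)}(t) \\ x_{\mathrm{in}}^{(k)}(t)\end{bmatrix}+B^{(k)}(t)u^{(k)}(t),\qquad y^{(k)}(t)=C^{(k)}(t)\begin{bmatrix} x^{(k)}(t) \\ x_{\mathrm{in}}^{(k)}(t)\end{bmatrix}+D^{(k)}(t)u^{(k)}(t),$$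 where the matrices are uniformly bounded in $t$. The quadruple $(A^{(k)}(t),B^{(k)}(t),C^{(k)}(t),D^{(k)}(t))$ is the realization of $G$. For a family $Z^{(ij)}(t)$ of matrices indexed by edges, $Z_{\mathrm{in}}^{(k)}(t)=\mathrm{diag}(Z^{(ik)}(t))_{i\in E_{\mathrm{in}}^{(k)}}$ and $Z_{\mathrm{out}}^{(k)}(t)=\mathrm{diag}(Z^{(kj)}(t))_{j\in E_{\mathrm{out}}^{(k)}}$ (block-diagonal). **Balanced realization.** The realization is balanced if there exist $\beta>0$ and uniformly bounded diagonal positive definite matrices $\Sigma^{(k)}(t)\succ\beta I$ (size $n^{(k)}(t)$), $\Sigma^{(ij)}(t)\succ\beta I$ (size $n^{(ij)}(t)$), called balanced generalized gramians, such that for all $(t,k)\in\mathbb{N}_0\times V$ $$A^{(k)}(t)\,\mathrm{diag}(\Sigma^{(k)}(t),\Sigma_{\mathrm{in}}^{(k)}(t))A^{(k)}(t)^T-\mathrm{diag}(\Sigma^{(k)}(t+1),\Sigma_{\mathrm{out}}^{(k)}(t+1))+B^{(k)}(t)B^{(k)}(t)^T\prec-\beta I,$$ $$A^{(k)}(t)^T\mathrm{diag}(\Sigma^{(k)}(t+1),\Sigma_{\mathrm{out}}^{(k)}(t+1))A^{(k)}(t)-\mathrm{diag}(\Sigma^{(k)}(t),\Sigma_{\mathrm{in}}^{(k)}(t))+C^{(k)}(t)^TC^{(k)}(t)\prec-\beta I.$$ The diagonal entries of each gramian are assumed, without loss of generality, ordered in a decreasing fashion. **Balanced truncation.** Given integers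 $0\le r^{(k)}(t)\le n^{(k)}(t)$ and $0\le r^{(ij)}(t)\le n^{(ij)}(t)$, write $\Sigma^{(k)}(t)=\mathrm{diag}(\Gamma^{(k)}(t),\Omega^{(k)}(t))$ and $\Sigma^{(ij)}(t)=\mathrm{diag}(\Gamma^{(ij)}(t),\Omega^{(ij)}(t))$ with $\Gamma^{(k)}(t)$ of size $r^{(k)}(t)$ and $\Gamma^{(ij)}(t)$ of size $r^{(ij)}(t)$ (blocks may have size zero). The reduced order system $G_r$, over the same graph, has temporal states of dimension $r^{(k)}(t)$, spatial states of dimension $r^{(ij)}(t)$, and realization $(A_r^{(k)}(t),B_r^{(k)}(t),C_r^{(k)}(t),D^{(k)}(t))$ obtained from that of $G$ by keeping, at each time, only the rows and columns corresponding to the first $r^{(k)}(t)$ components of each $x^{(k)}(t)$ and the first $r^{(ij)}(t)$ components of each $x^{(ij)}(t)$ (rows of $A^{(k)}(t)$, $B^{(k)}(t)$ according to the states at time $t+1$; columns of $A^{(k)}(t)$, $C^{(k)}(t)$ according to the states at time $t$). **Norm.** $\ell_2$ is the space of $w=(w^{(k)}(t))$ with $\|w\|_2=(\sum_{(t,k)}w^{(k)}(t)^Tw^{(k)}(t))^{1/2}<\infty$. For a system mapping $u\in\ell_2$ to $y\in\ell_2$ (from zero initial conditions), $\|G\|=\sup_{0\ne u\in\ell_2}\|y\|_2/\|u\|_2$. $G-G_r$ denotes the error system mapping $u$ to the difference of the outputs of $G$ and $G_r$. The bound may not be finite, as there may be infinitely many distinct diagonal entries in $\Omega$. *)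

theory Defs
  imports
    "HOL-Analysis.Infinite_Sum"
    "Jordan_Normal_Form.Matrix"
    "Jordan_Normal_Form.DL_Submatrix"
begin

text \<open>All matrices and vectors are of the types \<^typ>\<open>real mat\<close> and \<^typ>\<open>real vec\<close>, whose
  dimensions are natural numbers and may be zero.\<close>

section \<open>Distributed systems over a directed graph\<close>

text \<open>A state is attached to a vertex (temporal state) or to an edge (spatial state). Both kinds are
  indexed by one type, so that the sizes, the states and the gramians each form a single family.\<close>

datatype site = Node nat | Edge nat nat

record dist_system =
  num_nodes :: nat
  edges :: "(nat \<times> nat) set"
  state_dim :: "site \<Rightarrow> nat \<Rightarrow> nat"
  input_dim :: "nat \<Rightarrow> nat \<Rightarrow> nat"
  output_dim :: "nat \<Rightarrow> nat \<Rightarrow> nat"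
  matA :: "nat \<Rightarrow> nat \<Rightarrow> real mat"
  matB :: "nat \<Rightarrow> nat \<Rightarrow> real mat"
  matC :: "nat \<Rightarrow> nat \<Rightarrow> real mat"
  matD :: "nat \<Rightarrow> nat \<Rightarrow> real mat"

text \<open>Families indexed by \<^typ>\<open>nat \<Rightarrow> nat\<close> take the vertex first and the time second.\<close>

definition nodes :: "dist_system \<Rightarrow> nat set" where
  "nodes G = {1..num_nodes G}"

definition sites :: "dist_system \<Rightarrow> site set" where
  "sites G = Node ` nodes G \<union> (\<lambda>(i, j). Edge i j) ` edges G"

definition in_sites :: "dist_system \<Rightarrow> nat \<Rightarrow> site list" where
  "in_sites G k =
     Node k # map (\<lambda>i. Edge i k) (sorted_list_of_set {i \<in> nodes G. (i, k) \<in> edges G})"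

definition out_sites :: "dist_system \<Rightarrow> nat \<Rightarrow> site list" where
  "out_sites G k =
     Node k # map (\<lambda>j. Edge k j) (sorted_list_of_set {j \<in> nodes G. (k, j) \<in> edges G})"

definition total_dim :: "(site \<Rightarrow> nat \<Rightarrow> nat) \<Rightarrow> site list \<Rightarrow> nat \<Rightarrow> nat" where
  "total_dim n ls t = (\<Sum>l\<leftarrow>ls. n l t)"

text \<open>With \<^term>\<open>ls = in_sites G k\<close> the next two are the stacked vector of the temporal state and the
  incoming spatial states, and the block-diagonal matrix of the corresponding gramians;
  with \<^term>\<open>ls = out_sites G k\<close> likewise for the outgoing ones.\<close>

definition stack_at :: "(site \<Rightarrow> nat \<Rightarrow> real vec) \<Rightarrow> site list \<Rightarrow> nat \<Rightarrow> real vec" where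
  "stack_at x ls t = foldr (@\<^sub>v) (map (\<lambda>l. x l t) ls) (0\<^sub>v 0)"

definition diag_at :: "(site \<Rightarrow> nat \<Rightarrow> real mat) \<Rightarrow> site list \<Rightarrow> nat \<Rightarrow> real mat" where
  "diag_at Z ls t = diag_block_mat (map (\<lambda>l. Z l t) ls)"

definition vec_norm2 :: "real vec \<Rightarrow> real" where
  "vec_norm2 v = sqrt (scalar_prod v v)"

text \<open>Boundedness is meant in the operator norm; sizes are allowed to grow with time.\<close>

definition uniformly_bounded :: "'i set \<Rightarrow> ('i \<Rightarrow> nat \<Rightarrow> real mat) \<Rightarrow> bool" where
  "uniformly_bounded I Z \<longleftrightarrow>
     (\<exists>M. \<forall>i\<in>I. \<forall>t. \<forall>v\<in>carrier_vec (dim_col (Z i t)). vec_norm2 (Z i t *\<^sub>v v) \<le> M * vec_norm2 v)"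

definition well_dimensioned :: "dist_system \<Rightarrow> bool" where
  "well_dimensioned G \<longleftrightarrow>
     edges G \<subseteq> nodes G \<times> nodes G \<and>
     (\<forall>k\<in>nodes G. \<forall>t.
        matA G k t \<in> carrier_mat (total_dim (state_dim G) (out_sites G k) (t + 1))
                                 (total_dim (state_dim G) (in_sites G k) t) \<and>
        matB G k t \<in> carrier_mat (total_dim (state_dim G) (out_sites G k) (t + 1)) (input_dim G k t) \<and>
        matC G k t \<in> carrier_mat (output_dim G k t) (total_dim (state_dim G) (in_sites G k) t) \<and>
        matD G k t \<in> carrier_mat (output_dim G k t) (input_dim G k t))"

definition distributed_system :: "dist_system \<Rightarrow> bool" where
  "distributed_system G \<longleftrightarrow>
     well_dimensioned G \<and>
     uniformly_bounded (nodes G) (matA G) \<and> uniformly_bounded (nodes G) (matB G) \<and>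
     uniformly_bounded (nodes G) (matC G) \<and> uniformly_bounded (nodes G) (matD G)"

type_synonym signal = "nat \<Rightarrow> nat \<Rightarrow> real vec"

definition is_signal :: "nat \<Rightarrow> (nat \<Rightarrow> nat \<Rightarrow> nat) \<Rightarrow> signal \<Rightarrow> bool" where
  "is_signal N d w \<longleftrightarrow> (\<forall>k\<in>{1..N}. \<forall>t. w k t \<in> carrier_vec (d k t))"

definition trajectory :: "dist_system \<Rightarrow> signal \<Rightarrow> (site \<Rightarrow> nat \<Rightarrow> real vec) \<Rightarrow> signal \<Rightarrow> bool" where
  "trajectory G u x y \<longleftrightarrow>
     is_signal (num_nodes G) (input_dim G) u \<and>
     (\<forall>l\<in>sites G. \<forall>t. x l t \<in> carrier_vec (state_dim G l t)) \<and>
     (\<forall>l\<in>sites G. x l 0 = 0\<^sub>v (state_dim G l 0)) \<and>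
     (\<forall>k\<in>nodes G. \<forall>t.
        stack_at x (out_sites G k) (t + 1) =
          matA G k t *\<^sub>v stack_at x (in_sites G k) t + matB G k t *\<^sub>v u k t \<and>
        y k t = matC G k t *\<^sub>v stack_at x (in_sites G k) t + matD G k t *\<^sub>v u k t)"

text \<open>The input-output map of \<^term>\<open>G\<close>, as a relation; for a well-dimensioned system it is
  total, and single-valued on the vertices; see \<open>io_map_total\<close> and \<open>io_map_unique\<close> below.\<close>

definition io_map :: "dist_system \<Rightarrow> (signal \<times> signal) set" where
  "io_map G = {(u, y). \<exists>x. trajectory G u x y}"


lemma total_dim_simps [simp]:
  "total_dim n [] t = 0"
  "total_dim n (l # ls) t = n l t + total_dim n ls t"
  by (simp_all add: total_dim_def)

lemma set_in_sites:
  "set (in_sites G k) = insert (Node k) {Edge i k | i. i \<in> nodes G \<and> (i, k) \<in> edges G}"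
proof -
  have "finite {i \<in> nodes G. (i, k) \<in> edges G}" by (simp add: nodes_def)
  then show ?thesis by (auto simp: in_sites_def)
qed

lemma set_out_sites:
  "set (out_sites G k) = insert (Node k) {Edge k j | j. j \<in> nodes G \<and> (k, j) \<in> edges G}"
proof -
  have "finite {j \<in> nodes G. (k, j) \<in> edges G}" by (simp add: nodes_def)
  then show ?thesis by (auto simp: out_sites_def)
qed

lemma distinct_out_sites: "distinct (out_sites G k)"
  by (auto simp: out_sites_def distinct_map inj_on_def)

lemma in_out_sites_subset:
  "k \<in> nodes G \<Longrightarrow> set (in_sites G k) \<subseteq> sites G"
  "k \<in> nodes G \<Longrightarrow> set (out_sites G k) \<subseteq> sites G"
  by (auto simp: set_in_sites set_out_sites sites_def)

lemma sites_out_sites: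
  assumes "edges G \<subseteq> nodes G \<times> nodes G" "l \<in> sites G"
  obtains k where "k \<in> nodes G" "l \<in> set (out_sites G k)"
  using assms by (fastforce simp: sites_def set_out_sites)

lemma stack_at_simps [simp]:
  "stack_at x [] t = 0\<^sub>v 0"
  "stack_at x (l # ls) t = x l t @\<^sub>v stack_at x ls t"
  by (simp_all add: stack_at_def)

lemma stack_at_carrier:
  "(\<And>l. l \<in> set ls \<Longrightarrow> x l t \<in> carrier_vec (n l t)) \<Longrightarrow>
    stack_at x ls t \<in> carrier_vec (total_dim n ls t)"
  by (induction ls) auto

lemma stack_at_cong:
  "(\<And>l. l \<in> set ls \<Longrightarrow> x l t = x' l t) \<Longrightarrow> stack_at x ls t = stack_at x' ls t"
  by (induction ls) auto

lemma stack_at_split: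
  assumes "distinct ls" "v \<in> carrier_vec (total_dim n ls t)"
  shows "\<exists>f. (\<forall>l\<in>set ls. f l \<in> carrier_vec (n l t)) \<and> stack_at (\<lambda>l s. f l) ls t = v"
  using assms
proof (induction ls arbitrary: v)
  case Nil
  then show ?case by auto
next
  case (Cons l ls)
  let ?v2 = "vec_last v (total_dim n ls t)"
  obtain f where f: "\<forall>l\<in>set ls. f l \<in> carrier_vec (n l t)" "stack_at (\<lambda>l s. f l) ls t = ?v2"
    using Cons.IH[of ?v2] Cons.prems by auto
  let ?f = "f(l := vec_first v (n l t))"
  have "stack_at (\<lambda>l s. ?f l) ls t = stack_at (\<lambda>l s. f l) ls t"
    using Cons.prems by (intro stack_at_cong) auto
  then have "stack_at (\<lambda>l s. ?f l) (l # ls) t = vec_first v (n l t) @\<^sub>v ?v2"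
    using f by simp
  also have "\<dots> = v" using Cons.prems by simp
  finally show ?case using f by (intro exI[of _ ?f]) auto
qed

lemma stack_at_inject:
  assumes "stack_at x ls t = stack_at x' ls t" "l \<in> set ls"
    and "\<And>l. l \<in> set ls \<Longrightarrow> x l t \<in> carrier_vec (n l t)"
    and "\<And>l. l \<in> set ls \<Longrightarrow> x' l t \<in> carrier_vec (n l t)"
  shows "x l t = x' l t"
  using assms
proof (induction ls)
  case (Cons m ls)
  have "x m t = x' m t \<and> stack_at x ls t = stack_at x' ls t"
    using Cons.prems append_vec_eq[of "x m t" "n m t" "x' m t"] by auto
  then show ?case using Cons by auto
qed simp

lemma io_map_total:
  assumes G: "well_dimensioned G" and u: "is_signal (num_nodes G) (input_dim G) u"
  shows "\<exists>y. (u, y) \<in> io_map G"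
proof -
  let ?n = "state_dim G"
  let ?rhs = "\<lambda>k t f. matA G k t *\<^sub>v stack_at (\<lambda>l s. f l) (in_sites G k) t + matB G k t *\<^sub>v u k t"
  let ?P = "\<lambda>t f. (\<forall>l\<in>sites G. f l \<in> carrier_vec (?n l t)) \<and> (t = 0 \<longrightarrow> (\<forall>l\<in>sites G. f l = 0\<^sub>v (?n l 0)))"
  let ?Q = "\<lambda>t f g. \<forall>k\<in>nodes G. stack_at (\<lambda>l s. g l) (out_sites G k) (Suc t) = ?rhs k t f"
  have base: "\<exists>f. ?P 0 f" by (intro exI[of _ "\<lambda>l. 0\<^sub>v (?n l 0)"]) auto
  have step: "\<exists>g. ?P (Suc t) g \<and> ?Q t f g" if "?P t f" for f t
  proof -
    have "\<forall>k. \<exists>h. k \<in> nodes G \<longrightarrow> (\<forall>l\<in>set (out_sites G k). h l \<in> carrier_vec (?n l (Suc t))) \<and>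
        stack_at (\<lambda>l s. h l) (out_sites G k) (Suc t) = ?rhs k t f"
    proof
      fix k
      show "\<exists>h. k \<in> nodes G \<longrightarrow> (\<forall>l\<in>set (out_sites G k). h l \<in> carrier_vec (?n l (Suc t))) \<and>
        stack_at (\<lambda>l s. h l) (out_sites G k) (Suc t) = ?rhs k t f"
      proof (cases "k \<in> nodes G")
        case True
        have "matB G k t \<in> carrier_mat (total_dim ?n (out_sites G k) (Suc t)) (input_dim G k t)"
          using G True by (simp add: well_dimensioned_def)
        then have "?rhs k t f \<in> carrier_vec (total_dim ?n (out_sites G k) (Suc t))"
          by (intro carrier_vecI) simp
        from stack_at_split[OF distinct_out_sites this] obtain h where
          "\<forall>l\<in>set (out_sites G k). h l \<in> carrier_vec (?n l (Suc t))"
          "stack_at (\<lambda>l s. h l) (out_sites G k) (Suc t) = ?rhs k t f" by (elim exE conjE)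
        then show ?thesis by (intro exI[of _ h] impI conjI)
      qed simp
    qed
    from choice[OF this] obtain h where H: "\<forall>k. k \<in> nodes G \<longrightarrow>
        (\<forall>l\<in>set (out_sites G k). h k l \<in> carrier_vec (?n l (Suc t))) \<and>
        stack_at (\<lambda>l s. h k l) (out_sites G k) (Suc t) = ?rhs k t f" by (rule exE)
    have h: "k \<in> nodes G \<Longrightarrow> l \<in> set (out_sites G k) \<Longrightarrow> h k l \<in> carrier_vec (?n l (Suc t))"
      "k \<in> nodes G \<Longrightarrow> stack_at (\<lambda>l s. h k l) (out_sites G k) (Suc t) = ?rhs k t f" for k l
      using H by blast+
    define src where "src l = (case l of Node k \<Rightarrow> k | Edge k j \<Rightarrow> k)" for l
    have src: "src l = k" if "l \<in> set (out_sites G k)" for l k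
      using that by (auto simp: set_out_sites src_def)
    let ?g = "\<lambda>l. h (src l) l"
    have "?g l \<in> carrier_vec (?n l (Suc t))" if l: "l \<in> sites G" for l
    proof -
      obtain k where "k \<in> nodes G" "l \<in> set (out_sites G k)"
        using sites_out_sites[OF _ l] G unfolding well_dimensioned_def by blast
      then show ?thesis using h(1) src by auto
    qed
    moreover have "stack_at (\<lambda>l s. ?g l) (out_sites G k) (Suc t) = ?rhs k t f" if "k \<in> nodes G" for k
    proof -
      have "stack_at (\<lambda>l s. ?g l) (out_sites G k) (Suc t)
          = stack_at (\<lambda>l s. h k l) (out_sites G k) (Suc t)"
        by (rule stack_at_cong) (simp add: src)
      then show ?thesis using h(2)[OF that] by (rule trans)
    qed
    ultimately show ?thesis by (intro exI[of _ ?g] conjI ballI impI) simp_all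
  qed
  have "\<exists>f. \<forall>t. ?P t (f t) \<and> ?Q t (f t) (f (Suc t))"
    by (rule dependent_nat_choice[of ?P ?Q, OF base step])
  then obtain f where "\<forall>t. ?P t (f t) \<and> ?Q t (f t) (f (Suc t))" by (rule exE)
  then have f: "?P t (f t)" "?Q t (f t) (f (Suc t))" for t by blast+
  let ?x = "\<lambda>l t. f t l"
  have st: "stack_at (\<lambda>l s. f t l) ls t = stack_at ?x ls t" for ls t by (rule stack_at_cong) simp
  have "trajectory G u ?x
      (\<lambda>k t. matC G k t *\<^sub>v stack_at ?x (in_sites G k) t + matD G k t *\<^sub>v u k t)"
    using u f unfolding trajectory_def st by simp
  then show ?thesis by (auto simp: io_map_def)
qed

lemma io_map_unique:
  assumes G: "well_dimensioned G" and y: "(u, y) \<in> io_map G" "(u, y') \<in> io_map G"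
    and k: "k \<in> nodes G"
  shows "y k t = y' k t"
proof -
  obtain x x' where x: "trajectory G u x y" and x': "trajectory G u x' y'"
    using y by (auto simp: io_map_def)
  have "\<forall>l\<in>sites G. x l t = x' l t" for t
  proof (induction t)
    case 0
    then show ?case using x x' by (auto simp: trajectory_def)
  next
    case (Suc t)
    show ?case
    proof
      fix l assume "l \<in> sites G"
      then obtain k where k: "k \<in> nodes G" "l \<in> set (out_sites G k)"
        using sites_out_sites G unfolding well_dimensioned_def by blast
      have "stack_at x (in_sites G k) t = stack_at x' (in_sites G k) t"
        using Suc in_out_sites_subset(1)[OF k(1)] by (intro stack_at_cong) auto
      then have "stack_at x (out_sites G k) (Suc t) = stack_at x' (out_sites G k) (Suc t)"
        using x x' k by (simp add: trajectory_def)
      moreover have "x m (Suc t) \<in> carrier_vec (state_dim G m (Suc t))"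
        "x' m (Suc t) \<in> carrier_vec (state_dim G m (Suc t))" if "m \<in> set (out_sites G k)" for m
        using x x' in_out_sites_subset(2)[OF k(1)] that unfolding trajectory_def by blast+
      ultimately show "x l (Suc t) = x' l (Suc t)" by (rule stack_at_inject[OF _ k(2)])
    qed
  qed
  then have "stack_at x (in_sites G k) t = stack_at x' (in_sites G k) t"
    using in_out_sites_subset(1)[OF k] by (intro stack_at_cong) auto
  then show ?thesis using x x' k by (simp add: trajectory_def)
qed

section \<open>Norms\<close>

definition in_ell2 :: "nat \<Rightarrow> signal \<Rightarrow> bool" where
  "in_ell2 N w \<longleftrightarrow> (\<lambda>(t, k). scalar_prod (w k t) (w k t)) summable_on (UNIV \<times> {1..N})"

definition ell2_norm :: "nat \<Rightarrow> signal \<Rightarrow> ennreal" where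
  "ell2_norm N w =
     (if in_ell2 N w
      then ennreal (sqrt (\<Sum>\<^sub>\<infinity>(t, k)\<in>UNIV \<times> {1..N}. scalar_prod (w k t) (w k t)))
      else \<infinity>)"

definition nonzero_signal :: "nat \<Rightarrow> signal \<Rightarrow> bool" where
  "nonzero_signal N w \<longleftrightarrow> (\<exists>k\<in>{1..N}. \<exists>t. w k t \<noteq> 0\<^sub>v (dim_vec (w k t)))"

definition io_norm :: "nat \<Rightarrow> (signal \<times> signal) set \<Rightarrow> ennreal" where
  "io_norm N R =
     (SUP (u, y)\<in>{(u, y)\<in>R. in_ell2 N u \<and> nonzero_signal N u}. ell2_norm N y / ell2_norm N u)"

definition error_map :: "dist_system \<Rightarrow> dist_system \<Rightarrow> (signal \<times> signal) set" where
  "error_map G H = {(u, \<lambda>k t. y k t - z k t) | u y z. (u, y) \<in> io_map G \<and> (u, z) \<in> io_map H}"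


section \<open>Balanced realizations\<close>

definition mat_less :: "real mat \<Rightarrow> real mat \<Rightarrow> bool" (infix \<open>\<prec>\<^sub>L\<close> 50) where
  "X \<prec>\<^sub>L Y \<longleftrightarrow>
     (\<exists>n. X \<in> carrier_mat n n \<and> Y \<in> carrier_mat n n \<and> X\<^sup>T = X \<and> Y\<^sup>T = Y \<and>
          (\<forall>v\<in>carrier_vec n. v \<noteq> 0\<^sub>v n \<longrightarrow> scalar_prod v ((Y - X) *\<^sub>v v) > 0))"

definition decreasing_diag :: "real mat \<Rightarrow> bool" where
  "decreasing_diag X \<longleftrightarrow> (\<forall>a b. a \<le> b \<and> b < dim_row X \<longrightarrow> X $$ (b, b) \<le> X $$ (a, a))"

definition balanced_gramians :: "dist_system \<Rightarrow> (site \<Rightarrow> nat \<Rightarrow> real mat) \<Rightarrow> bool" where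
  "balanced_gramians G \<Sigma> \<longleftrightarrow>
     (\<forall>l\<in>sites G. \<forall>t. \<Sigma> l t \<in> carrier_mat (state_dim G l t) (state_dim G l t) \<and>
        diagonal_mat (\<Sigma> l t) \<and> decreasing_diag (\<Sigma> l t)) \<and>
     uniformly_bounded (sites G) \<Sigma> \<and>
     (\<exists>\<beta>>0.
        (\<forall>l\<in>sites G. \<forall>t. \<beta> \<cdot>\<^sub>m 1\<^sub>m (state_dim G l t) \<prec>\<^sub>L \<Sigma> l t) \<and>
        (\<forall>k\<in>nodes G. \<forall>t.
           let A = matA G k t; B = matB G k t; C = matC G k t;
               \<Sigma>in = diag_at \<Sigma> (in_sites G k) t;
               \<Sigma>out = diag_at \<Sigma> (out_sites G k) (t + 1)
           in A * \<Sigma>in * A\<^sup>T - \<Sigma>out + B * B\<^sup>T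
                \<prec>\<^sub>L (- \<beta>) \<cdot>\<^sub>m 1\<^sub>m (total_dim (state_dim G) (out_sites G k) (t + 1)) \<and>
              A\<^sup>T * \<Sigma>out * A - \<Sigma>in + C\<^sup>T * C
                \<prec>\<^sub>L (- \<beta>) \<cdot>\<^sub>m 1\<^sub>m (total_dim (state_dim G) (in_sites G k) t)))"


section \<open>Balanced truncation\<close>

text \<open>Positions, in a vector stacked along \<^term>\<open>ls\<close> with block sizes \<^term>\<open>n\<close>, of the first
  \<^term>\<open>r l t\<close> components of each block.\<close>

definition kept ::
  "(site \<Rightarrow> nat \<Rightarrow> nat) \<Rightarrow> (site \<Rightarrow> nat \<Rightarrow> nat) \<Rightarrow> site list \<Rightarrow> nat \<Rightarrow> nat set" where
  "kept n r ls t = {total_dim n (take p ls) t + a | p a. p < length ls \<and> a < r (ls ! p) t}"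

definition truncation :: "dist_system \<Rightarrow> (site \<Rightarrow> nat \<Rightarrow> nat) \<Rightarrow> dist_system" where
  "truncation G r = G\<lparr>
     state_dim := r,
     matA := \<lambda>k t. submatrix (matA G k t) (kept (state_dim G) r (out_sites G k) (t + 1))
                                          (kept (state_dim G) r (in_sites G k) t),
     matB := \<lambda>k t. submatrix (matB G k t) (kept (state_dim G) r (out_sites G k) (t + 1)) UNIV,
     matC := \<lambda>k t. submatrix (matC G k t) UNIV (kept (state_dim G) r (in_sites G k) t)\<rparr>"

lemma kept_Cons: "kept n r (l # ls) t = {..<r l t} \<union> (+) (n l t) ` kept n r ls t"
proof (intro equalityI subsetI)
  fix i assume "i \<in> kept n r (l # ls) t"
  then obtain p a where p: "i = total_dim n (take p (l # ls)) t + a" "p < Suc (length ls)"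
      "a < r ((l # ls) ! p) t"
    by (auto simp: kept_def)
  show "i \<in> {..<r l t} \<union> (+) (n l t) ` kept n r ls t"
  proof (cases p)
    case 0
    then show ?thesis using p by simp
  next
    case (Suc q)
    then have "i = n l t + (total_dim n (take q ls) t + a)" "q < length ls" "a < r (ls ! q) t"
      using p by auto
    then show ?thesis unfolding kept_def by blast
  qed
next
  fix i assume "i \<in> {..<r l t} \<union> (+) (n l t) ` kept n r ls t"
  then consider "i < r l t"
    | q a where "i = n l t + (total_dim n (take q ls) t + a)" "q < length ls" "a < r (ls ! q) t"
    by (auto simp: kept_def)
  then show "i \<in> kept n r (l # ls) t"
  proof cases
    case 1
    then show ?thesis unfolding kept_def by (intro CollectI exI[of _ 0] exI[of _ i]) simp
  next
    case 2
    then show ?thesis unfolding kept_def by (intro CollectI exI[of _ "Suc q"] exI[of _ a]) simp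
  qed
qed

lemma card_kept:
  assumes "\<And>l. l \<in> set ls \<Longrightarrow> r l t \<le> n l t"
  shows "card {i. i < total_dim n ls t \<and> i \<in> kept n r ls t} = total_dim r ls t"
proof -
  have "kept n r ls t \<subseteq> {..<total_dim n ls t} \<and> card (kept n r ls t) = total_dim r ls t"
    using assms
  proof (induction ls)
    case Nil
    then show ?case by (simp add: kept_def)
  next
    case (Cons l ls)
    then have IH: "kept n r ls t \<subseteq> {..<total_dim n ls t}" "card (kept n r ls t) = total_dim r ls t"
      and le: "r l t \<le> n l t" by auto
    have "finite (kept n r ls t)" using IH(1) finite_subset by blast
    moreover have "{..<r l t} \<inter> (+) (n l t) ` kept n r ls t = {}" using le by auto
    ultimately have "card (kept n r (l # ls) t) = r l t + total_dim r ls t"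
      unfolding kept_Cons using IH(2) by (subst card_Un_disjoint) (auto simp: card_image)
    moreover have "kept n r (l # ls) t \<subseteq> {..<total_dim n (l # ls) t}"
      unfolding kept_Cons using IH(1) le by auto
    ultimately show ?case by simp
  qed
  moreover from this have "{i. i < total_dim n ls t \<and> i \<in> kept n r ls t} = kept n r ls t" by blast
  ultimately show ?thesis by simp
qed

lemma truncation_sel [simp]:
  "num_nodes (truncation G r) = num_nodes G" "edges (truncation G r) = edges G"
  "state_dim (truncation G r) = r"
  "input_dim (truncation G r) = input_dim G" "output_dim (truncation G r) = output_dim G"
  "matA (truncation G r) k t =
     submatrix (matA G k t) (kept (state_dim G) r (out_sites G k) (t + 1))
                            (kept (state_dim G) r (in_sites G k) t)"
  "matB (truncation G r) k t =
     submatrix (matB G k t) (kept (state_dim G) r (out_sites G k) (t + 1)) UNIV"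
  "matC (truncation G r) k t =
     submatrix (matC G k t) UNIV (kept (state_dim G) r (in_sites G k) t)"
  "matD (truncation G r) k t = matD G k t"
  by (simp_all add: truncation_def)

lemma truncation_well_dimensioned:
  assumes G: "well_dimensioned G" and r: "\<forall>l\<in>sites G. \<forall>t. r l t \<le> state_dim G l t"
  shows "well_dimensioned (truncation G r)"
proof -
  have eqs: "nodes (truncation G r) = nodes G" "in_sites (truncation G r) k = in_sites G k"
      "out_sites (truncation G r) k = out_sites G k" for k
    by (simp_all add: nodes_def in_sites_def out_sites_def)
  have "card {i. i < total_dim (state_dim G) (in_sites G k) t \<and>
          i \<in> kept (state_dim G) r (in_sites G k) t} = total_dim r (in_sites G k) t"
       "card {i. i < total_dim (state_dim G) (out_sites G k) t \<and>
          i \<in> kept (state_dim G) r (out_sites G k) t} = total_dim r (out_sites G k) t"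
    if "k \<in> nodes G" for k t
    using in_out_sites_subset[OF that] r by (intro card_kept; blast)+
  note card = this
  have edges: "edges G \<subseteq> nodes G \<times> nodes G" using G by (simp add: well_dimensioned_def)
  have "matA (truncation G r) k t \<in> carrier_mat (total_dim r (out_sites G k) (t + 1)) (total_dim r (in_sites G k) t)"
       "matB (truncation G r) k t \<in> carrier_mat (total_dim r (out_sites G k) (t + 1)) (input_dim G k t)"
       "matC (truncation G r) k t \<in> carrier_mat (output_dim G k t) (total_dim r (in_sites G k) t)"
       "matD (truncation G r) k t \<in> carrier_mat (output_dim G k t) (input_dim G k t)"
    if k: "k \<in> nodes G" for k t
  proof -
    have M: "matA G k t \<in> carrier_mat (total_dim (state_dim G) (out_sites G k) (t + 1))
                                     (total_dim (state_dim G) (in_sites G k) t)"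
      "matB G k t \<in> carrier_mat (total_dim (state_dim G) (out_sites G k) (t + 1)) (input_dim G k t)"
      "matC G k t \<in> carrier_mat (output_dim G k t) (total_dim (state_dim G) (in_sites G k) t)"
      "matD G k t \<in> carrier_mat (output_dim G k t) (input_dim G k t)"
      using G k unfolding well_dimensioned_def by blast+
    note d = M[THEN carrier_matD(1)] M[THEN carrier_matD(2)]
    show "matA (truncation G r) k t \<in> carrier_mat (total_dim r (out_sites G k) (t + 1)) (total_dim r (in_sites G k) t)"
      by (rule carrier_matI) (simp_all only: truncation_sel dim_submatrix d card[OF k])
    show "matB (truncation G r) k t \<in> carrier_mat (total_dim r (out_sites G k) (t + 1)) (input_dim G k t)"
      by (rule carrier_matI) (simp_all add: dim_submatrix d card[OF k] del: Suc_eq_plus1 add_Suc_right One_nat_def)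
    show "matC (truncation G r) k t \<in> carrier_mat (output_dim G k t) (total_dim r (in_sites G k) t)"
      by (rule carrier_matI) (simp_all add: dim_submatrix d card[OF k] del: Suc_eq_plus1 add_Suc_right One_nat_def)
    show "matD (truncation G r) k t \<in> carrier_mat (output_dim G k t) (input_dim G k t)"
      using M(4) by (simp only: truncation_sel)
  qed
  then show ?thesis
    using edges unfolding well_dimensioned_def eqs truncation_sel(2-5) by blast
qed

text \<open>A possibly infinite square matrix is given by its index set and its entries. The block-diagonal
  matrix below has blocks \<^term>\<open>W l t\<close>; its index \<open>(l, t, a)\<close> is the \<open>a\<close>-th row
  of block \<open>(l, t)\<close>, so blocks of size zero contribute nothing.\<close>

definition block_diag_index ::
  "dist_system \<Rightarrow> (site \<Rightarrow> nat \<Rightarrow> real mat) \<Rightarrow> (site \<times> nat \<times> nat) set" where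
  "block_diag_index G W = {(l, t, a). l \<in> sites G \<and> a < dim_row (W l t)}"

definition block_diag ::
  "(site \<Rightarrow> nat \<Rightarrow> real mat) \<Rightarrow> site \<times> nat \<times> nat \<Rightarrow> site \<times> nat \<times> nat \<Rightarrow> real" where
  "block_diag W = (\<lambda>(l, t, a) (l', t', b). if l = l' \<and> t = t' then W l t $$ (a, b) else 0)"

text \<open>Extended-real valued because there may be infinitely many distinct entries; meaningful for
  matrices with nonnegative diagonal only, as \<^const>\<open>ennreal\<close> truncates negative numbers.\<close>

definition distinct_diag_sum :: "'i set \<Rightarrow> ('i \<Rightarrow> 'i \<Rightarrow> real) \<Rightarrow> ennreal" where
  "distinct_diag_sum I X = (\<Sum>\<^sub>\<infinity>s\<in>(\<lambda>i. X i i) ` I. ennreal s)"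

end

theory Submission
  imports Defs "HOL-Analysis.L2_Norm"
begin

text \<open>Suppose first that all removed diagonal entries equal one number \<open>s\<close>, at whatever times and
  sites they occur. Let \<open>x\<close> and \<open>y\<close> be the states of the two systems, the second one padded with
  zeros. In each step the energy \<open>(x - y)\<^sup>T \<Sigma> (x - y) + s\<^sup>2 (x + y)\<^sup>T \<Sigma>\<^sup>-\<^sup>1 (x + y)\<close>, summed over all
  sites, grows by at most \<open>4 \<gamma> s\<^sup>2 |u|\<^sup>2\<close> minus the squared output error, where the uniform
  margin \<open>\<beta>\<close> makes \<open>\<gamma> < 1\<close>. Hence the error gain is at most \<open>2 s \<surd>\<gamma>\<close>. If finitely many
  values occur, remove them one after the other and use the triangle inequality; the factor
  \<open>\<surd>\<gamma>\<close> gives strictness. If infinitely many occur, the bound is infinite since all of them exceed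
  \<open>\<beta>\<close>, and the error gain is finite by stability.\<close>

section \<open>Dissipation at one vertex in one time step\<close>

text \<open>The form of the energy is forced by the two inequalities. The difference
  \<open>x - y\<close> loses the input, so observability bounds it together with the output error.
  The sum \<open>x + y\<close> is driven by \<open>2 * u\<close>, the origin of the factor 4, and is
  bounded by the dual of controllability, whose natural weight is the inverse gramian. Neither part
  is dissipated alone: discarding an update \<open>h\<close> of \<open>y\<close> next to an update
  \<open>f\<close> of \<open>x\<close> creates cross terms in \<open>f * h\<close> of opposite sign
  in the two parts. They cancel exactly when the weights \<sigma> and s^2/\<sigma> agree, that is
  for \<sigma> = s; this is why one value is removed at a time. Strictness for each single input
  could be lost in the supremum, so the margin has to become one factor \<gamma> < 1; it is placed
  on the controllability side because the input enters there. After removing one value the remaining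
  coordinates need not be initial segments of their blocks. Intermediate systems therefore stay on
  the full coordinate set, with a mask that resets coordinates to zero, and the same matrices and
  gramian inequalities serve every stage.\<close>

locale gramian_step =
  fixes I I' J Y :: "nat set" and a b c :: "nat \<Rightarrow> nat \<Rightarrow> real"
    and \<sigma> \<sigma>' :: "nat \<Rightarrow> real" and \<gamma> :: real
  assumes \<gamma>_pos: "0 < \<gamma>"
    and \<sigma>_pos: "j \<in> I \<Longrightarrow> 0 < \<sigma> j"
    and \<sigma>'_pos: "i \<in> I' \<Longrightarrow> 0 < \<sigma>' i"
    and observability: "(\<Sum>i\<in>I'. \<sigma>' i * (\<Sum>j\<in>I. a i j * v j)\<^sup>2) + (\<Sum>e\<in>Y. (\<Sum>j\<in>I. c e j * v j)\<^sup>2)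
          \<le> (\<Sum>j\<in>I. \<sigma> j * (v j)\<^sup>2)"
    and controllability: "(\<Sum>j\<in>I. \<sigma> j * (\<Sum>i\<in>I'. a i j * q i)\<^sup>2) + (\<Sum>m\<in>J. (\<Sum>i\<in>I'. b i m * q i)\<^sup>2)
          \<le> \<gamma> * (\<Sum>i\<in>I'. \<sigma>' i * (q i)\<^sup>2)"
begin

definition next_state :: "(nat \<Rightarrow> real) \<Rightarrow> (nat \<Rightarrow> real) \<Rightarrow> nat \<Rightarrow> real" where
  "next_state x u i = (\<Sum>j\<in>I. a i j * x j) + (\<Sum>m\<in>J. b i m * u m)"

text \<open>The dual form of the controllability inequality, obtained by testing it with
  \<open>next_state x u / \<sigma>'\<close>.\<close>

lemma reachability:
  "(\<Sum>i\<in>I'. (next_state x u i)\<^sup>2 / \<sigma>' i) \<le> \<gamma> * ((\<Sum>j\<in>I. (x j)\<^sup>2 / \<sigma> j) + (\<Sum>m\<in>J. (u m)\<^sup>2))"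
    (is "?E \<le> _")
proof -
  let ?q = "\<lambda>i. next_state x u i / \<sigma>' i"
  let ?\<alpha> = "\<lambda>j. \<Sum>i\<in>I'. a i j * ?q i" and ?\<beta> = "\<lambda>m. \<Sum>i\<in>I'. b i m * ?q i"
  \<comment> \<open>The weights are chosen so that, after summation, the first terms form the left
    side of \<open>controllability\<close> divided by \<gamma>, and the second terms form the
    claimed bound.\<close>
  have young: "2 * (p * y) \<le> s * p\<^sup>2 / \<gamma> + \<gamma> * (y\<^sup>2 / s)" if "0 < s" for p y s :: real
  proof -
    have "0 \<le> (s * p - \<gamma> * y)\<^sup>2 / (s * \<gamma>)" using that \<gamma>_pos by simp
    also have "\<dots> = s * p\<^sup>2 / \<gamma> + \<gamma> * (y\<^sup>2 / s) - 2 * (p * y)"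
      using that \<gamma>_pos by (simp add: field_simps power2_eq_square)
    finally show ?thesis by simp
  qed
  have "?E = (\<Sum>i\<in>I'. ?q i * next_state x u i)"
    by (simp add: power2_eq_square)
  also have "\<dots> = (\<Sum>i\<in>I'. \<Sum>j\<in>I. a i j * ?q i * x j) + (\<Sum>i\<in>I'. \<Sum>m\<in>J. b i m * ?q i * u m)"
  proof -
    have "q * next_state x u i = (\<Sum>j\<in>I. a i j * q * x j) + (\<Sum>m\<in>J. b i m * q * u m)" for q i
      by (simp add: next_state_def distrib_left sum_distrib_left mult_ac)
    then show ?thesis by (simp only: sum.distrib)
  qed
  also have "\<dots> = (\<Sum>j\<in>I. ?\<alpha> j * x j) + (\<Sum>m\<in>J. ?\<beta> m * u m)"
    by (simp only: sum_distrib_right sum.swap[of _ I' I] sum.swap[of _ I' J])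
  finally have E: "?E = \<dots>" .
  \<comment> \<open>Doubling pays for the test vector: \<open>controllability\<close> at
    \<open>?q\<close> returns one copy of \<open>?E\<close> on the right, which is then
    cancelled.\<close>
  have "2 * ?E = (\<Sum>j\<in>I. 2 * (?\<alpha> j * x j)) + (\<Sum>m\<in>J. 2 * (?\<beta> m * u m))"
    unfolding E by (simp only: distrib_left sum_distrib_left)
  also have "\<dots> \<le> (\<Sum>j\<in>I. \<sigma> j * (?\<alpha> j)\<^sup>2 / \<gamma> + \<gamma> * ((x j)\<^sup>2 / \<sigma> j))
      + (\<Sum>m\<in>J. 1 * (?\<beta> m)\<^sup>2 / \<gamma> + \<gamma> * ((u m)\<^sup>2 / 1))"
    by (intro add_mono sum_mono young) (auto simp: \<sigma>_pos)
  also have "\<dots> = ((\<Sum>j\<in>I. \<sigma> j * (?\<alpha> j)\<^sup>2) + (\<Sum>m\<in>J. (?\<beta> m)\<^sup>2)) / \<gamma>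
      + \<gamma> * ((\<Sum>j\<in>I. (x j)\<^sup>2 / \<sigma> j) + (\<Sum>m\<in>J. (u m)\<^sup>2))"
    by (simp add: sum.distrib sum_distrib_left sum_divide_distrib add_divide_distrib distrib_left)
  also have "((\<Sum>j\<in>I. \<sigma> j * (?\<alpha> j)\<^sup>2) + (\<Sum>m\<in>J. (?\<beta> m)\<^sup>2)) / \<gamma> \<le> (\<Sum>i\<in>I'. \<sigma>' i * (?q i)\<^sup>2)"
    using controllability[of ?q] \<gamma>_pos by (simp add: pos_divide_le_eq mult.commute)
  also have "(\<Sum>i\<in>I'. \<sigma>' i * (?q i)\<^sup>2) = ?E"
    using \<sigma>'_pos by (intro sum.cong) (force simp: power2_eq_square)+
  finally show ?thesis by simp
qed

text \<open>Resetting coordinates only drops nonnegative terms, so the contraction estimate is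
  available for every mask.\<close>

lemma masked_reachability:
  "(\<Sum>i\<in>I'. (if K i then next_state x u i else 0)\<^sup>2 / \<sigma>' i)
     \<le> \<gamma> * ((\<Sum>j\<in>I. (x j)\<^sup>2 / \<sigma> j) + (\<Sum>m\<in>J. (u m)\<^sup>2))"
proof -
  have "(\<Sum>i\<in>I'. (if K i then next_state x u i else 0)\<^sup>2 / \<sigma>' i) \<le> (\<Sum>i\<in>I'. (next_state x u i)\<^sup>2 / \<sigma>' i)"
    by (intro sum_mono) (auto intro!: divide_nonneg_pos simp: \<sigma>'_pos)
  also note reachability
  finally show ?thesis .
qed

text \<open>For a coordinate that is removed, \<open>f\<close> and \<open>h\<close> being the updates of the two systems, the
  new energy is \<open>2sf\<^sup>2\<close>, while the two Lyapunov inequalities control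
  \<open>s(f-h)\<^sup>2 + s(f+h)\<^sup>2 = 2sf\<^sup>2 + 2sh\<^sup>2\<close>.\<close>

lemma truncation_dissipation:
  fixes x y u :: "nat \<Rightarrow> real"
  assumes K: "\<And>i. K' i \<Longrightarrow> K i" and s: "\<And>i. i \<in> I' \<Longrightarrow> K i \<Longrightarrow> \<not> K' i \<Longrightarrow> \<sigma>' i = s"
  defines "f \<equiv> \<lambda>i. if K i then next_state x u i else 0"
    and "h \<equiv> \<lambda>i. if K' i then next_state y u i else 0"
  shows "(\<Sum>i\<in>I'. \<sigma>' i * (f i - h i)\<^sup>2) + s\<^sup>2 * (\<Sum>i\<in>I'. (f i + h i)\<^sup>2 / \<sigma>' i)
          + (\<Sum>e\<in>Y. (\<Sum>j\<in>I. c e j * (x j - y j))\<^sup>2)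
     \<le> (\<Sum>j\<in>I. \<sigma> j * (x j - y j)\<^sup>2)
          + \<gamma> * s\<^sup>2 * ((\<Sum>j\<in>I. (x j + y j)\<^sup>2 / \<sigma> j) + 4 * (\<Sum>m\<in>J. (u m)\<^sup>2))"
proof -
  let ?z = "\<lambda>i. \<Sum>j\<in>I. a i j * (x j - y j)"
  \<comment> \<open>Both systems receive \<open>u\<close>, so their sum is a state update with input
    \<open>2 * u\<close>; squaring gives the factor 4.\<close>
  let ?w = "next_state (\<lambda>j. x j + y j) (\<lambda>m. 2 * u m)"
  have z: "?z i = next_state x u i - next_state y u i" for i
    by (simp add: next_state_def algebra_simps sum_subtractf)
  have w: "?w i = next_state x u i + next_state y u i" for i
    by (simp add: next_state_def algebra_simps sum.distrib sum_distrib_left)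
  have "\<sigma>' i * (f i - h i)\<^sup>2 + s\<^sup>2 * ((f i + h i)\<^sup>2 / \<sigma>' i) \<le> \<sigma>' i * (?z i)\<^sup>2 + s\<^sup>2 * ((?w i)\<^sup>2 / \<sigma>' i)"
    if i: "i \<in> I'" for i
  proof (cases "K' i \<or> \<not> K i")
    \<comment> \<open>Kept by both systems or dropped from both: the two sides agree, or the left
      one is zero.\<close>
    case True
    then show ?thesis using K[of i] \<sigma>'_pos[OF i] by (auto simp: z w f_def h_def)
  next
    case False
    then have "\<sigma>' i = s" "s > 0" using s i \<sigma>'_pos[OF i] by auto
    moreover have "s * p\<^sup>2 + s\<^sup>2 * (p\<^sup>2 / s) \<le> s * (p - q)\<^sup>2 + s\<^sup>2 * ((p + q)\<^sup>2 / s)" for p q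
    proof -
      have "s\<^sup>2 * (d\<^sup>2 / s) = s * d\<^sup>2" for d
        using \<open>s > 0\<close> by (simp add: power2_eq_square)
      moreover have "s * p\<^sup>2 + s * p\<^sup>2 \<le> s * (p - q)\<^sup>2 + s * (p + q)\<^sup>2"
        using \<open>s > 0\<close> by (simp add: power2_sum power2_diff distrib_left right_diff_distrib)
      ultimately show ?thesis by simp
    qed
    ultimately show ?thesis using False by (simp add: z w f_def h_def)
  qed
  then have "(\<Sum>i\<in>I'. \<sigma>' i * (f i - h i)\<^sup>2) + s\<^sup>2 * (\<Sum>i\<in>I'. (f i + h i)\<^sup>2 / \<sigma>' i)
      \<le> (\<Sum>i\<in>I'. \<sigma>' i * (?z i)\<^sup>2) + s\<^sup>2 * (\<Sum>i\<in>I'. (?w i)\<^sup>2 / \<sigma>' i)"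
    unfolding sum_distrib_left sum.distrib[symmetric] by (rule sum_mono)
  moreover have "s\<^sup>2 * (\<Sum>i\<in>I'. (?w i)\<^sup>2 / \<sigma>' i)
      \<le> s\<^sup>2 * (\<gamma> * ((\<Sum>j\<in>I. (x j + y j)\<^sup>2 / \<sigma> j) + (\<Sum>m\<in>J. (2 * u m)\<^sup>2)))"
    by (intro mult_left_mono reachability) simp
  moreover have "(\<Sum>m\<in>J. (2 * u m)\<^sup>2) = 4 * (\<Sum>m\<in>J. (u m)\<^sup>2)"
    by (simp add: power_mult_distrib sum_distrib_left)
  ultimately show ?thesis using observability[of "\<lambda>j. x j - y j"] by (simp add: mult_ac)
qed

end

section \<open>Coordinates of stacked vectors\<close>

text \<open>Inverts the stacking: a flat position is traced back to its site and its offset there.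
  Pairs of this kind are independent of the vertex at which a site is stacked, so incoming and
  outgoing stacks become comparable. The value for the empty list is never reached at positions
  below \<open>total_dim\<close>.\<close>

fun coord :: "(site \<Rightarrow> nat \<Rightarrow> nat) \<Rightarrow> site list \<Rightarrow> nat \<Rightarrow> nat \<Rightarrow> site \<times> nat" where
  "coord n [] t i = undefined"
| "coord n (l # ls) t i = (if i < n l t then (l, i) else coord n ls t (i - n l t))"

lemma coord_mem:
  "i < total_dim n ls t \<Longrightarrow> coord n ls t i \<in> Sigma (set ls) (\<lambda>l. {..<n l t})"
proof (induction ls arbitrary: i)
  case (Cons l ls)
  show ?case
  proof (cases "i < n l t")
    case False
    then have "coord n ls t (i - n l t) \<in> Sigma (set ls) (\<lambda>l. {..<n l t})"
      using Cons.prems by (intro Cons.IH) simp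
    then show ?thesis using False by auto
  qed simp
qed simp

lemma bij_betw_coord:
  assumes "distinct ls"
  shows "bij_betw (coord n ls t) {..<total_dim n ls t} (Sigma (set ls) (\<lambda>l. {..<n l t}))"
  using assms
proof (induction ls)
  case (Cons l ls)
  let ?N = "total_dim n ls t"
  have "bij_betw (coord n (l # ls) t) {..<n l t} ({l} \<times> {..<n l t})"
    by (auto simp: bij_betw_def inj_on_def image_def)
  moreover have "bij_betw (coord n (l # ls) t) {n l t..<n l t + ?N} (Sigma (set ls) (\<lambda>l. {..<n l t}))"
  proof -
    have "bij_betw (\<lambda>i. i - n l t) {n l t..<n l t + ?N} {..<?N}"
      by (rule bij_betw_byWitness[of _ "\<lambda>i. i + n l t"]) auto
    from bij_betw_trans[OF this Cons.IH] have
      "bij_betw (coord n ls t \<circ> (\<lambda>i. i - n l t)) {n l t..<n l t + ?N} (Sigma (set ls) (\<lambda>l. {..<n l t}))"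
      using Cons.prems by simp
    then show ?thesis by (subst bij_betw_cong) auto
  qed
  ultimately have "bij_betw (coord n (l # ls) t) ({..<n l t} \<union> {n l t..<n l t + ?N})
      ({l} \<times> {..<n l t} \<union> Sigma (set ls) (\<lambda>l. {..<n l t}))"
    by (rule bij_betw_combine) (use Cons.prems in auto)
  moreover have "{..<n l t} \<union> {n l t..<n l t + ?N} = {..<total_dim n (l # ls) t}" by auto
  moreover have "{l} \<times> {..<n l t} \<union> Sigma (set ls) (\<lambda>l. {..<n l t}) = Sigma (set (l # ls)) (\<lambda>l. {..<n l t})"
    by auto
  ultimately show ?case by (simp only:)
qed (simp add: bij_betw_def)

lemma sum_coord:
  assumes "distinct ls"
  shows "(\<Sum>i<total_dim n ls t. f (coord n ls t i)) = (\<Sum>l\<in>set ls. \<Sum>a<n l t. f (l, a))"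
  by (simp add: sum.reindex_bij_betw[OF bij_betw_coord[OF assms]] sum.Sigma)

lemma stack_at_coord:
  assumes "\<And>l. l \<in> set ls \<Longrightarrow> x l t \<in> carrier_vec (n l t)" "i < total_dim n ls t"
  shows "stack_at x ls t $ i = (case coord n ls t i of (l, a) \<Rightarrow> x l t $ a)"
  using assms
proof (induction ls arbitrary: i)
  case (Cons l ls)
  have "stack_at x ls t \<in> carrier_vec (total_dim n ls t)" "x l t \<in> carrier_vec (n l t)"
    using Cons.prems by (auto intro: stack_at_carrier)
  then have "stack_at x (l # ls) t $ i
      = (if i < n l t then x l t $ i else stack_at x ls t $ (i - n l t))"
    using Cons.prems(2) by simp
  moreover have "stack_at x ls t $ (i - n l t) = (case coord n ls t (i - n l t) of (l, a) \<Rightarrow> x l t $ a)"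
    if "\<not> i < n l t"
    using that Cons.prems by (intro Cons.IH) auto
  ultimately show ?case by simp
qed simp

lemma diag_at_carrier:
  assumes "\<And>l. l \<in> set ls \<Longrightarrow> Z l t \<in> carrier_mat (n l t) (n l t)"
  shows "diag_at Z ls t \<in> carrier_mat (total_dim n ls t) (total_dim n ls t)"
  using assms
proof (induction ls)
  case (Cons l ls)
  then have "diag_at Z ls t \<in> carrier_mat (total_dim n ls t) (total_dim n ls t)"
    "Z l t \<in> carrier_mat (n l t) (n l t)" by auto
  then show ?case by (auto simp: diag_at_def Let_def)
qed (auto simp: diag_at_def)

lemma diag_at_coord:
  assumes "\<And>l. l \<in> set ls \<Longrightarrow> Z l t \<in> carrier_mat (n l t) (n l t)"
    and "\<And>l. l \<in> set ls \<Longrightarrow> diagonal_mat (Z l t)"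
    and "i < total_dim n ls t" "j < total_dim n ls t"
  shows "diag_at Z ls t $$ (i, j) = (if i = j then case coord n ls t i of (l, a) \<Rightarrow> Z l t $$ (a, a) else 0)"
  using assms
proof (induction ls arbitrary: i j)
  case (Cons l ls)
  have c: "diag_at Z ls t \<in> carrier_mat (total_dim n ls t) (total_dim n ls t)"
    "Z l t \<in> carrier_mat (n l t) (n l t)"
    using Cons.prems by (auto intro: diag_at_carrier)
  have "diag_at Z (l # ls) t = four_block_mat (Z l t) (0\<^sub>m (n l t) (total_dim n ls t))
      (0\<^sub>m (total_dim n ls t) (n l t)) (diag_at Z ls t)"
    using c by (simp add: diag_at_def Let_def)
  then have "diag_at Z (l # ls) t $$ (i, j)
      = (if i < n l t then if j < n l t then Z l t $$ (i, j) else 0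
         else if j < n l t then 0 else diag_at Z ls t $$ (i - n l t, j - n l t))"
    using Cons.prems(3,4) carrier_matD[OF c(1)] carrier_matD[OF c(2)] by simp
  moreover have "Z l t $$ (i, j) = (if i = j then Z l t $$ (i, i) else 0)" if "i < n l t" "j < n l t"
    using that Cons.prems(2)[of l] carrier_matD[OF c(2)] by (simp add: diagonal_mat_def)
  moreover have "diag_at Z ls t $$ (i - n l t, j - n l t)
      = (if i - n l t = j - n l t then case coord n ls t (i - n l t) of (l, a) \<Rightarrow> Z l t $$ (a, a) else 0)"
    if "\<not> i < n l t" "\<not> j < n l t"
    using that Cons.prems by (intro Cons.IH) auto
  ultimately show ?case by auto
qed simp

lemma kept_coord:
  assumes "\<And>l. l \<in> set ls \<Longrightarrow> r l t \<le> n l t" "i < total_dim n ls t"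
  shows "i \<in> kept n r ls t \<longleftrightarrow> (case coord n ls t i of (l, a) \<Rightarrow> a < r l t)"
  using assms
proof (induction ls arbitrary: i)
  case (Cons l ls)
  show ?case
  proof (cases "i < n l t")
    case True
    then show ?thesis by (auto simp: kept_Cons)
  next
    case False
    then have "i \<in> kept n r (l # ls) t \<longleftrightarrow> i - n l t \<in> kept n r ls t"
      using Cons.prems(1)[of l] by (auto simp: kept_Cons intro!: image_eqI[of _ _ "i - n l t"])
    also have "\<dots> \<longleftrightarrow> (case coord n ls t (i - n l t) of (l, a) \<Rightarrow> a < r l t)"
      using False Cons.prems by (intro Cons.IH) auto
    finally show ?thesis using False by simp
  qed
qed (simp add: kept_def)

section \<open>Order-preserving enumeration of the kept positions\<close>

lemma kept_subset:
  assumes "\<And>l. l \<in> set ls \<Longrightarrow> r l t \<le> n l t"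
  shows "kept n r ls t \<subseteq> {..<total_dim n ls t}"
  using assms
proof (induction ls)
  case (Cons l ls)
  then have "kept n r ls t \<subseteq> {..<total_dim n ls t}" "r l t \<le> n l t" by auto
  then show ?case by (auto simp: kept_Cons)
qed (simp add: kept_def)

lemma finite_kept:
  assumes "\<And>l. l \<in> set ls \<Longrightarrow> r l t \<le> n l t"
  shows "finite (kept n r ls t)"
  using kept_subset[of ls r t n] assms finite_subset by blast

lemma card_kept_eq:
  assumes "\<And>l. l \<in> set ls \<Longrightarrow> r l t \<le> n l t"
  shows "card (kept n r ls t) = total_dim r ls t"
proof -
  have "{i. i < total_dim n ls t \<and> i \<in> kept n r ls t} = kept n r ls t"
    using kept_subset[of ls r t n] assms by blast
  then show ?thesis using card_kept[of ls r t n] assms by simp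
qed

text \<open>An element of a set is its \<open>i\<close>-th one once exactly \<open>i\<close>
  elements lie below it. Here the first block contributes \<open>r l t\<close> smaller elements, all
  below the shifted copy of the remaining positions because
  \<open>r l t \<le> n l t\<close>.\<close>

lemma pick_kept_Cons:
  assumes le: "\<And>m. m \<in> set (l # ls) \<Longrightarrow> r m t \<le> n m t" and i: "i < total_dim r (l # ls) t"
  shows "pick (kept n r (l # ls) t) i = (if i < r l t then i else n l t + pick (kept n r ls t) (i - r l t))"
proof -
  let ?K = "kept n r ls t" and ?L = "kept n r (l # ls) t"
  have rn: "r l t \<le> n l t" using le by simp
  have fin: "finite ?K" using le by (intro finite_kept) simp
  show ?thesis
  proof (cases "i < r l t")
    case True
    then have "{a \<in> ?L. a < i} = {..<i}" "i \<in> ?L" using rn by (auto simp: kept_Cons)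
    then show ?thesis using True pick_card_in_set[of i ?L] by simp
  next
    case False
    let ?p = "pick ?K (i - r l t)"
    have "card ?K = total_dim r ls t" using le by (intro card_kept_eq) simp
    then have c: "i - r l t < card ?K" using i False by simp
    have "{a \<in> ?L. a < n l t + ?p} = {..<r l t} \<union> (+) (n l t) ` {a \<in> ?K. a < ?p}"
      using rn by (auto simp: kept_Cons)
    moreover have "card ({..<r l t} \<union> (+) (n l t) ` {a \<in> ?K. a < ?p}) = r l t + (i - r l t)"
      using fin rn card_pick_le[OF c] by (subst card_Un_disjoint) (auto simp: card_image)
    ultimately have "card {a \<in> ?L. a < n l t + ?p} = i" using False by simp
    moreover have "n l t + ?p \<in> ?L" using pick_in_set_le[OF c] by (simp add: kept_Cons)
    ultimately show ?thesis using False pick_card_in_set[of "n l t + ?p" ?L] by simp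
  qed
qed

text \<open>Truncation keeps initial segments of the blocks, so site and offset survive although the
  flat position moves. This lets the truncated and the full system share one set of
  coordinates.\<close>

lemma coord_pick_kept:
  assumes "\<And>l. l \<in> set ls \<Longrightarrow> r l t \<le> n l t" "i < total_dim r ls t"
  shows "coord n ls t (pick (kept n r ls t) i) = coord r ls t i"
  using assms
proof (induction ls arbitrary: i)
  case (Cons l ls)
  have le: "r l t \<le> n l t" using Cons.prems by simp
  have p: "pick (kept n r (l # ls) t) i
      = (if i < r l t then i else n l t + pick (kept n r ls t) (i - r l t))"
    using Cons.prems by (rule pick_kept_Cons)
  show ?case
  proof (cases "i < r l t")
    case True
    then show ?thesis using le by (simp add: p)
  next
    case False
    then have "coord n ls t (pick (kept n r ls t) (i - r l t)) = coord r ls t (i - r l t)"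
      using Cons.prems by (intro Cons.IH) auto
    then show ?thesis using False by (simp add: p)
  qed
qed simp

text \<open>Counting the smaller elements is a left inverse; surjectivity follows by comparing
  cardinalities.\<close>

lemma bij_betw_pick:
  assumes "finite K"
  shows "bij_betw (pick K) {..<card K} K"
proof -
  have "inj_on (pick K) {..<card K}"
    by (rule inj_on_inverseI[of _ "\<lambda>a. card {a' \<in> K. a' < a}"]) (simp add: card_pick_le)
  moreover have "pick K ` {..<card K} \<subseteq> K" using pick_in_set_le by auto
  ultimately show ?thesis
    using card_subset_eq[of K "pick K ` {..<card K}"] assms by (simp add: bij_betw_def card_image)
qed

section \<open>Lyapunov inequalities in coordinates\<close>

lemma scalar_prod_eq_sum:
  "v \<in> carrier_vec n \<Longrightarrow> w \<bullet> v = (\<Sum>i<n. w $ i * v $ i)"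
  by (simp add: scalar_prod_def atLeast0LessThan)

text \<open>Passing to the weak inequality includes the zero vector; the quantitative strictness is
  carried by the margin \<open>\<beta>\<close> in the matrices compared.\<close>

lemma mat_less_nonneg:
  assumes "X \<prec>\<^sub>L Y" "X \<in> carrier_mat n n" "v \<in> carrier_vec n"
  shows "v \<bullet> (X *\<^sub>v v) \<le> v \<bullet> (Y *\<^sub>v v)"
proof -
  have Y: "Y \<in> carrier_mat n n" using assms(1,2) by (auto simp: mat_less_def)
  have "0 \<le> v \<bullet> ((Y - X) *\<^sub>v v)"
  proof (cases "v = 0\<^sub>v n")
    case True
    have "(Y - X) *\<^sub>v v \<in> carrier_vec n"
      using assms(2) by (intro carrier_vecI) simp
    then show ?thesis using True by simp
  next
    case False
    then show ?thesis using assms by (auto simp: mat_less_def intro: less_imp_le)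
  qed
  also have "v \<bullet> ((Y - X) *\<^sub>v v) = v \<bullet> (Y *\<^sub>v v) - v \<bullet> (X *\<^sub>v v)"
    using assms Y by (simp add: minus_mult_distrib_mat_vec scalar_prod_minus_distrib[of v n])
  finally show ?thesis by simp
qed

lemma quadratic_form_diagonal:
  fixes S :: "'a :: comm_semiring_1 mat"
  assumes S: "S \<in> carrier_mat n n" and v: "v \<in> carrier_vec n"
    and d: "\<And>i j. i < n \<Longrightarrow> j < n \<Longrightarrow> S $$ (i, j) = (if i = j then s i else 0)"
  shows "v \<bullet> (S *\<^sub>v v) = (\<Sum>i<n. s i * (v $ i)\<^sup>2)"
proof -
  have Sv: "S *\<^sub>v v \<in> carrier_vec n" using S by (intro carrier_vecI) simp
  have "(S *\<^sub>v v) $ i = (\<Sum>j<n. S $$ (i, j) * v $ j)" if "i < n" for i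
    using S v that by (simp add: scalar_prod_eq_sum[OF v])
  then have "v \<bullet> (S *\<^sub>v v) = (\<Sum>i<n. v $ i * (\<Sum>j<n. S $$ (i, j) * v $ j))"
    unfolding scalar_prod_eq_sum[OF Sv] by (intro sum.cong) auto
  also have "\<dots> = (\<Sum>i<n. v $ i * (s i * v $ i))"
  proof (intro sum.cong refl arg_cong[where f = "(*) _"])
    fix i assume "i \<in> {..<n}"
    then have "(\<Sum>j<n. S $$ (i, j) * v $ j) = (\<Sum>j<n. if i = j then s i * v $ j else 0)"
      by (intro sum.cong) (auto simp: d)
    then show "(\<Sum>j<n. S $$ (i, j) * v $ j) = s i * v $ i" using \<open>i \<in> {..<n}\<close> by simp
  qed
  also have "\<dots> = (\<Sum>i<n. s i * (v $ i)\<^sup>2)"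
    by (intro sum.cong) (simp_all add: power2_eq_square mult_ac)
  finally show ?thesis .
qed

lemma transpose_mult_vec_index:
  fixes A :: "'a :: comm_semiring_1 mat"
  assumes "A \<in> carrier_mat n' n" "j < n"
  shows "(A\<^sup>T *\<^sub>v vec n' q) $ j = (\<Sum>i<n'. A $$ (i, j) * q i)"
  using assms by (simp add: scalar_prod_eq_sum[of _ n'])

text \<open>Tests the matrix inequality with the vector \<open>q\<close> and moves the margin into
  the weights \<open>s' i - \<beta>\<close>. It is stated for arbitrary matrices so that transposes
  can be inserted, which yields the observability inequality from the same lemma.\<close>

lemma lyapunov_coordinates:
  fixes A B S S' :: "real mat"
  assumes A: "A \<in> carrier_mat n' n" and B: "B \<in> carrier_mat n' m"
    and S: "S \<in> carrier_mat n n" "\<And>i j. i < n \<Longrightarrow> j < n \<Longrightarrow> S $$ (i, j) = (if i = j then s i else 0)"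
    and S': "S' \<in> carrier_mat n' n'"
      "\<And>i j. i < n' \<Longrightarrow> j < n' \<Longrightarrow> S' $$ (i, j) = (if i = j then s' i else 0)"
    and lyap: "A * S * A\<^sup>T - S' + B * B\<^sup>T \<prec>\<^sub>L (- \<beta>) \<cdot>\<^sub>m 1\<^sub>m n'"
  shows "(\<Sum>j<n. s j * (\<Sum>i<n'. A $$ (i, j) * q i)\<^sup>2) + (\<Sum>j<m. (\<Sum>i<n'. B $$ (i, j) * q i)\<^sup>2)
      \<le> (\<Sum>i<n'. (s' i - \<beta>) * (q i)\<^sup>2)"
proof -
  define v where "v = vec n' q"
  have v: "v \<in> carrier_vec n'" by (simp add: v_def)
  have Av: "A\<^sup>T *\<^sub>v v \<in> carrier_vec n" "B\<^sup>T *\<^sub>v v \<in> carrier_vec m" using A B by (auto intro!: carrier_vecI)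
  have ASA: "v \<bullet> ((A * S * A\<^sup>T) *\<^sub>v v) = (\<Sum>j<n. s j * (\<Sum>i<n'. A $$ (i, j) * q i)\<^sup>2)"
  proof -
    have "v \<bullet> ((A * S * A\<^sup>T) *\<^sub>v v) = v \<bullet> (A *\<^sub>v (S *\<^sub>v (A\<^sup>T *\<^sub>v v)))"
      using A S(1) v by (simp add: assoc_mult_mat_vec[of _ n' n _ n'] assoc_mult_mat_vec[of _ n' n _ n])
    also have "\<dots> = (A\<^sup>T *\<^sub>v v) \<bullet> (S *\<^sub>v (A\<^sup>T *\<^sub>v v))"
      using A S(1) v Av by (intro transpose_vec_mult_scalar[symmetric, where nr = n' and nc = n]) auto
    also have "\<dots> = (\<Sum>j<n. s j * ((A\<^sup>T *\<^sub>v v) $ j)\<^sup>2)"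
      by (rule quadratic_form_diagonal[OF S(1) Av(1) S(2)])
    also have "\<dots> = (\<Sum>j<n. s j * (\<Sum>i<n'. A $$ (i, j) * q i)\<^sup>2)"
      unfolding v_def using A by (intro sum.cong) (simp_all only: transpose_mult_vec_index lessThan_iff)
    finally show ?thesis .
  qed
  have BB: "v \<bullet> ((B * B\<^sup>T) *\<^sub>v v) = (\<Sum>j<m. (\<Sum>i<n'. B $$ (i, j) * q i)\<^sup>2)"
  proof -
    have "v \<bullet> ((B * B\<^sup>T) *\<^sub>v v) = v \<bullet> (B *\<^sub>v (B\<^sup>T *\<^sub>v v))"
      using B v by (simp add: assoc_mult_mat_vec[of _ n' m _ n'])
    also have "\<dots> = (B\<^sup>T *\<^sub>v v) \<bullet> (B\<^sup>T *\<^sub>v v)"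
      using B v Av by (intro transpose_vec_mult_scalar[symmetric, where nr = n' and nc = m]) auto
    also have "\<dots> = (\<Sum>j<m. ((B\<^sup>T *\<^sub>v v) $ j)\<^sup>2)"
      by (simp only: scalar_prod_eq_sum[OF Av(2)] power2_eq_square)
    also have "\<dots> = (\<Sum>j<m. (\<Sum>i<n'. B $$ (i, j) * q i)\<^sup>2)"
      unfolding v_def using B by (intro sum.cong) (simp_all only: transpose_mult_vec_index lessThan_iff)
    finally show ?thesis .
  qed
  have S'v: "v \<bullet> (S' *\<^sub>v v) = (\<Sum>i<n'. s' i * (q i)\<^sup>2)"
    using quadratic_form_diagonal[OF S'(1) v S'(2)] by (simp add: v_def)
  have Iv: "v \<bullet> (((- \<beta>) \<cdot>\<^sub>m 1\<^sub>m n') *\<^sub>v v) = (\<Sum>i<n'. - \<beta> * (q i)\<^sup>2)"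
    by (subst quadratic_form_diagonal[of _ n' _ "\<lambda>_. - \<beta>"]) (auto simp: v_def)
  have c: "A * S * A\<^sup>T \<in> carrier_mat n' n'" "B * B\<^sup>T \<in> carrier_mat n' n'" using A B S by auto
  have "v \<bullet> ((A * S * A\<^sup>T - S' + B * B\<^sup>T) *\<^sub>v v) \<le> v \<bullet> (((- \<beta>) \<cdot>\<^sub>m 1\<^sub>m n') *\<^sub>v v)"
    using c S' v by (intro mat_less_nonneg[OF lyap]) auto
  also have "v \<bullet> ((A * S * A\<^sup>T - S' + B * B\<^sup>T) *\<^sub>v v)
      = v \<bullet> ((A * S * A\<^sup>T) *\<^sub>v v) - v \<bullet> (S' *\<^sub>v v) + v \<bullet> ((B * B\<^sup>T) *\<^sub>v v)"
  proof -
    have vc: "(A * S * A\<^sup>T) *\<^sub>v v \<in> carrier_vec n'" "S' *\<^sub>v v \<in> carrier_vec n'"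
      "(B * B\<^sup>T) *\<^sub>v v \<in> carrier_vec n'"
      using c S' v mult_mat_vec_carrier by blast+
    have "(A * S * A\<^sup>T - S' + B * B\<^sup>T) *\<^sub>v v
        = (A * S * A\<^sup>T) *\<^sub>v v - S' *\<^sub>v v + (B * B\<^sup>T) *\<^sub>v v"
      using c S'(1) v by (simp only: add_mult_distrib_mat_vec[OF minus_carrier_mat[OF S'(1)] c(2) v]
          minus_mult_distrib_mat_vec[OF c(1) S'(1) v])
    then show ?thesis
      using vc v by (simp only: scalar_prod_add_distrib[OF v minus_carrier_vec[OF vc(1,2)] vc(3)]
          scalar_prod_minus_distrib[OF v vc(1,2)])
  qed
  finally show ?thesis unfolding ASA BB S'v Iv
    by (simp add: left_diff_distrib sum_subtractf sum_negf)
qed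

section \<open>Error dynamics of truncated systems\<close>

text \<open>Fixes the witnesses of the existential conditions and replaces definiteness and
  boundedness of the gramians by bounds on their entries, so that one contraction factor can be
  defined for all times and sites.\<close>

locale balanced_system =
  fixes G :: dist_system and \<Sigma> :: "site \<Rightarrow> nat \<Rightarrow> real mat" and \<beta> M :: real
  assumes well_dimensioned: "well_dimensioned G"
    and \<beta>_pos: "0 < \<beta>"
    and gramian: "l \<in> sites G \<Longrightarrow> \<Sigma> l t \<in> carrier_mat (state_dim G l t) (state_dim G l t)"
      "l \<in> sites G \<Longrightarrow> diagonal_mat (\<Sigma> l t)"
    and gramian_bounds: "l \<in> sites G \<Longrightarrow> a < state_dim G l t \<Longrightarrow> \<beta> < \<Sigma> l t $$ (a, a)"
      "l \<in> sites G \<Longrightarrow> a < state_dim G l t \<Longrightarrow> \<Sigma> l t $$ (a, a) \<le> M"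
    and lyapunov_controllability: "k \<in> nodes G \<Longrightarrow>
      matA G k t * diag_at \<Sigma> (in_sites G k) t * (matA G k t)\<^sup>T - diag_at \<Sigma> (out_sites G k) (Suc t)
        + matB G k t * (matB G k t)\<^sup>T
      \<prec>\<^sub>L (- \<beta>) \<cdot>\<^sub>m 1\<^sub>m (total_dim (state_dim G) (out_sites G k) (Suc t))"
    and lyapunov_observability: "k \<in> nodes G \<Longrightarrow>
      (matA G k t)\<^sup>T * diag_at \<Sigma> (out_sites G k) (Suc t) * matA G k t - diag_at \<Sigma> (in_sites G k) t
        + (matC G k t)\<^sup>T * matC G k t
      \<prec>\<^sub>L (- \<beta>) \<cdot>\<^sub>m 1\<^sub>m (total_dim (state_dim G) (in_sites G k) t)"
begin

abbreviation n_in where "n_in k t \<equiv> total_dim (state_dim G) (in_sites G k) t"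
abbreviation n_out where "n_out k t \<equiv> total_dim (state_dim G) (out_sites G k) (Suc t)"
abbreviation c_in where "c_in k t \<equiv> coord (state_dim G) (in_sites G k) t"
abbreviation c_out where "c_out k t \<equiv> coord (state_dim G) (out_sites G k) (Suc t)"

definition \<sigma> :: "nat \<Rightarrow> site \<times> nat \<Rightarrow> real" where
  "\<sigma> t p = (case p of (l, a) \<Rightarrow> \<Sigma> l t $$ (a, a))"

definition coords :: "nat \<Rightarrow> (site \<times> nat) set" where
  "coords t = Sigma (sites G) (\<lambda>l. {..<state_dim G l t})"

text \<open>Chosen so that \<sigma> - \<beta> \<le> \<gamma> \<sigma> whenever \<sigma> \<le> M. The
  absolute value and the summand \<open>2 * \<beta>\<close> keep \<gamma> strictly between 0 and 1
  even if there are no states and \<open>M\<close> is arbitrary.\<close>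

definition \<gamma> :: real where "\<gamma> = 1 - \<beta> / (\<bar>M\<bar> + 2 * \<beta>)"

lemma \<gamma>_bounds: "0 < \<gamma>" "\<gamma> < 1"
  using \<beta>_pos by (auto simp: \<gamma>_def field_simps)

lemma \<sigma>_bounds:
  assumes "p \<in> coords t"
  shows "0 < \<sigma> t p" "\<beta> \<le> \<sigma> t p" "\<sigma> t p \<le> M" "\<sigma> t p - \<beta> \<le> \<gamma> * \<sigma> t p"
proof -
  show "\<beta> \<le> \<sigma> t p" and M: "\<sigma> t p \<le> M"
    using assms gramian_bounds by (force simp: coords_def \<sigma>_def)+
  then show pos: "0 < \<sigma> t p" using \<beta>_pos by simp
  have "\<beta> * \<sigma> t p / (\<bar>M\<bar> + 2 * \<beta>) \<le> \<beta>"
    using M \<beta>_pos by (simp add: pos_divide_le_eq)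
  then show "\<sigma> t p - \<beta> \<le> \<gamma> * \<sigma> t p" by (simp add: \<gamma>_def left_diff_distrib)
qed

lemma dims:
  assumes "k \<in> nodes G"
  shows "matA G k t \<in> carrier_mat (n_out k t) (n_in k t)"
    "matB G k t \<in> carrier_mat (n_out k t) (input_dim G k t)"
    "matC G k t \<in> carrier_mat (output_dim G k t) (n_in k t)"
    "matD G k t \<in> carrier_mat (output_dim G k t) (input_dim G k t)"
  using well_dimensioned assms by (auto simp: well_dimensioned_def)

lemma edges_subset: "edges G \<subseteq> nodes G \<times> nodes G"
  using well_dimensioned by (simp add: well_dimensioned_def)

lemma finite_sites: "finite (sites G)"
proof -
  have "finite (edges G)"
    using edges_subset by (rule finite_subset) (simp add: nodes_def)
  then show ?thesis by (simp add: sites_def nodes_def)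
qed

lemma distinct_in_sites: "distinct (in_sites G k)"
  by (auto simp: in_sites_def distinct_map inj_on_def)

lemma c_in_coords: "k \<in> nodes G \<Longrightarrow> j < n_in k t \<Longrightarrow> c_in k t j \<in> coords t"
  using coord_mem[of j "state_dim G" "in_sites G k" t] in_out_sites_subset(1)[of k G]
  by (auto simp: coords_def)

lemma c_out_coords: "k \<in> nodes G \<Longrightarrow> i < n_out k t \<Longrightarrow> c_out k t i \<in> coords (Suc t)"
  using coord_mem[of i "state_dim G" "out_sites G k" "Suc t"] in_out_sites_subset(2)[of k G]
  by (auto simp: coords_def)

text \<open>Every temporal state belongs to its own vertex and every spatial state enters exactly
  one vertex, the head of its edge; hence no coordinate is missed or counted twice.\<close>

lemma sum_c_in: "(\<Sum>k\<in>nodes G. \<Sum>j<n_in k t. f (c_in k t j)) = sum f (coords t)"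
proof -
  have "(\<Sum>k\<in>nodes G. \<Sum>j<n_in k t. f (c_in k t j))
      = (\<Sum>k\<in>nodes G. \<Sum>l\<in>set (in_sites G k). \<Sum>a<state_dim G l t. f (l, a))"
    by (simp only: sum_coord[OF distinct_in_sites])
  also have "\<dots> = (\<Sum>l\<in>(\<Union>k\<in>nodes G. set (in_sites G k)). \<Sum>a<state_dim G l t. f (l, a))"
    by (rule sum.UNION_disjoint[symmetric]) (auto simp: nodes_def set_in_sites)
  also have "(\<Union>k\<in>nodes G. set (in_sites G k)) = sites G"
    using edges_subset by (fastforce simp: set_in_sites sites_def)
  finally show ?thesis by (simp add: coords_def sum.Sigma finite_sites)
qed

text \<open>The counterpart for tails of edges. Together with \<open>sum_c_in\<close> it makes the
  energy sent out by all vertices equal to the energy received by all vertices at the next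
  time.\<close>

lemma sum_c_out: "(\<Sum>k\<in>nodes G. \<Sum>i<n_out k t. f (c_out k t i)) = sum f (coords (Suc t))"
proof -
  have "(\<Sum>k\<in>nodes G. \<Sum>i<n_out k t. f (c_out k t i))
      = (\<Sum>k\<in>nodes G. \<Sum>l\<in>set (out_sites G k). \<Sum>a<state_dim G l (Suc t). f (l, a))"
    by (simp only: sum_coord[OF distinct_out_sites])
  also have "\<dots> = (\<Sum>l\<in>(\<Union>k\<in>nodes G. set (out_sites G k)). \<Sum>a<state_dim G l (Suc t). f (l, a))"
    by (rule sum.UNION_disjoint[symmetric]) (auto simp: nodes_def set_out_sites)
  also have "(\<Union>k\<in>nodes G. set (out_sites G k)) = sites G"
    using edges_subset by (fastforce simp: set_out_sites sites_def)
  finally show ?thesis by (simp add: coords_def sum.Sigma finite_sites)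
qed

lemma diag_at_in:
  assumes "k \<in> nodes G"
  shows "diag_at \<Sigma> (in_sites G k) t \<in> carrier_mat (n_in k t) (n_in k t)"
    "i < n_in k t \<Longrightarrow> j < n_in k t \<Longrightarrow>
      diag_at \<Sigma> (in_sites G k) t $$ (i, j) = (if i = j then \<sigma> t (c_in k t i) else 0)"
  using in_out_sites_subset(1)[OF assms] gramian unfolding \<sigma>_def
  by (intro diag_at_carrier diag_at_coord; blast)+

lemma diag_at_out:
  assumes "k \<in> nodes G"
  shows "diag_at \<Sigma> (out_sites G k) (Suc t) \<in> carrier_mat (n_out k t) (n_out k t)"
    "i < n_out k t \<Longrightarrow> j < n_out k t \<Longrightarrow>
      diag_at \<Sigma> (out_sites G k) (Suc t) $$ (i, j) = (if i = j then \<sigma> (Suc t) (c_out k t i) else 0)"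
  using in_out_sites_subset(2)[OF assms] gramian unfolding \<sigma>_def
  by (intro diag_at_carrier diag_at_coord; blast)+

lemma gramian_step:
  assumes k: "k \<in> nodes G"
  shows "gramian_step {..<n_in k t} {..<n_out k t} {..<input_dim G k t} {..<output_dim G k t}
    (\<lambda>i j. matA G k t $$ (i, j)) (\<lambda>i j. matB G k t $$ (i, j)) (\<lambda>i j. matC G k t $$ (i, j))
    (\<lambda>j. \<sigma> t (c_in k t j)) (\<lambda>i. \<sigma> (Suc t) (c_out k t i)) \<gamma>"
proof
  note d = dims[OF k]
  fix v q :: "nat \<Rightarrow> real"
  let ?\<sigma> = "\<lambda>j. \<sigma> t (c_in k t j)" and ?\<sigma>' = "\<lambda>i. \<sigma> (Suc t) (c_out k t i)"
  have At: "(matA G k t)\<^sup>T \<in> carrier_mat (n_in k t) (n_out k t)"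
    and Ct: "(matC G k t)\<^sup>T \<in> carrier_mat (n_in k t) (output_dim G k t)"
    using d by simp_all
  \<comment> \<open>Observability is controllability of the transposed data: \<open>C\<close>
    transposed replaces \<open>B\<close>, and the gramians at the two times exchange roles.\<close>
  have "(\<Sum>i<n_out k t. ?\<sigma>' i * (\<Sum>j<n_in k t. (matA G k t)\<^sup>T $$ (j, i) * v j)\<^sup>2)
      + (\<Sum>e<output_dim G k t. (\<Sum>j<n_in k t. (matC G k t)\<^sup>T $$ (j, e) * v j)\<^sup>2)
      \<le> (\<Sum>j<n_in k t. (?\<sigma> j - \<beta>) * (v j)\<^sup>2)"
    using lyapunov_observability[OF k]
    by (intro lyapunov_coordinates[OF At Ct diag_at_out[OF k] diag_at_in[OF k]]) simp_all
  also have "\<dots> \<le> (\<Sum>j<n_in k t. ?\<sigma> j * (v j)\<^sup>2)"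
    using \<beta>_pos by (intro sum_mono mult_right_mono) auto
  finally show "(\<Sum>i<n_out k t. ?\<sigma>' i * (\<Sum>j<n_in k t. matA G k t $$ (i, j) * v j)\<^sup>2)
      + (\<Sum>e<output_dim G k t. (\<Sum>j<n_in k t. matC G k t $$ (e, j) * v j)\<^sup>2)
      \<le> (\<Sum>j<n_in k t. ?\<sigma> j * (v j)\<^sup>2)"
    using carrier_matD[OF d(1)] carrier_matD[OF d(3)] by simp
  have "(\<Sum>j<n_in k t. ?\<sigma> j * (\<Sum>i<n_out k t. matA G k t $$ (i, j) * q i)\<^sup>2)
      + (\<Sum>m<input_dim G k t. (\<Sum>i<n_out k t. matB G k t $$ (i, m) * q i)\<^sup>2)
      \<le> (\<Sum>i<n_out k t. (?\<sigma>' i - \<beta>) * (q i)\<^sup>2)"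
    by (intro lyapunov_coordinates[OF d(1,2) diag_at_in[OF k] diag_at_out[OF k]]
        lyapunov_controllability k)
  \<comment> \<open>The additive margin becomes a multiplicative factor, uniformly because all
    entries are at most \<open>M\<close>.\<close>
  also have "\<dots> \<le> (\<Sum>i<n_out k t. \<gamma> * ?\<sigma>' i * (q i)\<^sup>2)"
    using k by (intro sum_mono mult_right_mono \<sigma>_bounds c_out_coords) auto
  finally show "(\<Sum>j<n_in k t. ?\<sigma> j * (\<Sum>i<n_out k t. matA G k t $$ (i, j) * q i)\<^sup>2)
      + (\<Sum>m<input_dim G k t. (\<Sum>i<n_out k t. matB G k t $$ (i, m) * q i)\<^sup>2)
      \<le> \<gamma> * (\<Sum>i<n_out k t. ?\<sigma>' i * (q i)\<^sup>2)"
    by (simp add: sum_distrib_left mult.assoc)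
qed (use k in \<open>auto intro!: \<sigma>_bounds(1) c_in_coords c_out_coords simp: \<gamma>_bounds\<close>)

section \<open>Masked dynamics on the full coordinate set\<close>

definition update :: "nat \<Rightarrow> nat \<Rightarrow> (site \<times> nat \<Rightarrow> real) \<Rightarrow> signal \<Rightarrow> nat \<Rightarrow> real" where
  "update k t x u i = (\<Sum>j<n_in k t. matA G k t $$ (i, j) * x (c_in k t j))
     + (\<Sum>m<input_dim G k t. matB G k t $$ (i, m) * u k t $ m)"

text \<open>The feedthrough term is left out because it is common to both systems and cancels in the
  output error.\<close>

definition response :: "nat \<Rightarrow> nat \<Rightarrow> (site \<times> nat \<Rightarrow> real) \<Rightarrow> nat \<Rightarrow> real" where
  "response k t x e = (\<Sum>j<n_in k t. matC G k t $$ (e, j) * x (c_in k t j))"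

text \<open>Truncated systems are represented without changing dimensions: all coordinates outside the
  mask \<open>K\<close> are reset to zero after each step.\<close>

definition masked_states :: "(nat \<Rightarrow> site \<times> nat \<Rightarrow> bool) \<Rightarrow> signal \<Rightarrow> (nat \<Rightarrow> site \<times> nat \<Rightarrow> real) \<Rightarrow> bool" where
  "masked_states K u x \<longleftrightarrow> (\<forall>p\<in>coords 0. x 0 p = 0) \<and>
     (\<forall>t. \<forall>k\<in>nodes G. \<forall>i<n_out k t.
        x (Suc t) (c_out k t i) = (if K (Suc t) (c_out k t i) then update k t (x t) u i else 0))"

definition input_energy :: "signal \<Rightarrow> nat \<Rightarrow> real" where
  "input_energy u t = (\<Sum>k\<in>nodes G. \<Sum>m<input_dim G k t. (u k t $ m)\<^sup>2)"

definition output_energy :: "(nat \<Rightarrow> site \<times> nat \<Rightarrow> real) \<Rightarrow> (nat \<Rightarrow> site \<times> nat \<Rightarrow> real) \<Rightarrow> nat \<Rightarrow> real" where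
  "output_energy x y t = (\<Sum>k\<in>nodes G. \<Sum>e<output_dim G k t. (response k t (x t) e - response k t (y t) e)\<^sup>2)"

lemma response_diff: "response k t x e - response k t y e = response k t (\<lambda>p. x p - y p) e"
  by (simp add: response_def algebra_simps sum_subtractf)

text \<open>Supplies states for intermediate masks, which need not come from any
  \<open>truncation\<close>. The vertex updating a site is the tail of the edge, and inverting
  \<open>coord\<close> recovers the row of that vertex's matrices.\<close>

primrec masked_solution :: "(nat \<Rightarrow> site \<times> nat \<Rightarrow> bool) \<Rightarrow> signal \<Rightarrow> nat \<Rightarrow> site \<times> nat \<Rightarrow> real" where
  "masked_solution K u 0 = (\<lambda>p. 0)"
| "masked_solution K u (Suc t) = (\<lambda>p. if K (Suc t) p
     then let k = (case fst p of Node k \<Rightarrow> k | Edge k j \<Rightarrow> k)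
          in update k t (masked_solution K u t) u (inv_into {..<n_out k t} (c_out k t) p)
     else 0)"

lemma masked_states_masked_solution: "masked_states K u (masked_solution K u)"
proof -
  have "(case fst (c_out k t i) of Node k \<Rightarrow> k | Edge k j \<Rightarrow> k) = k"
    "inv_into {..<n_out k t} (c_out k t) (c_out k t i) = i" if "i < n_out k t" for k t i
  proof -
    show "(case fst (c_out k t i) of Node k \<Rightarrow> k | Edge k j \<Rightarrow> k) = k"
      using coord_mem[OF that] by (auto simp: set_out_sites)
    show "inv_into {..<n_out k t} (c_out k t) (c_out k t i) = i"
      using bij_betw_coord[OF distinct_out_sites] that
      by (intro inv_into_f_f) (auto simp: bij_betw_def)
  qed
  then show ?thesis by (simp add: masked_states_def Let_def)
qed

lemma masked_states_cong:
  assumes "masked_states K u x" "\<And>t p. p \<in> coords t \<Longrightarrow> K t p = K' t p"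
  shows "masked_states K' u x"
  using assms c_out_coords by (auto simp: masked_states_def)

section \<open>Energy estimates over finite horizons\<close>

lemma truncation_step:
  assumes x: "masked_states K u x" and y: "masked_states K' u y"
    and K: "\<And>t p. K' t p \<Longrightarrow> K t p"
    and s: "\<And>t p. p \<in> coords t \<Longrightarrow> K t p \<Longrightarrow> \<not> K' t p \<Longrightarrow> \<sigma> t p = s"
  defines "V \<equiv> \<lambda>t. \<Sum>p\<in>coords t. \<sigma> t p * (x t p - y t p)\<^sup>2"
    and "W \<equiv> \<lambda>t. \<Sum>p\<in>coords t. (x t p + y t p)\<^sup>2 / \<sigma> t p"
  shows "V (Suc t) + s\<^sup>2 * W (Suc t) + output_energy x y t
    \<le> V t + \<gamma> * s\<^sup>2 * (W t + 4 * input_energy u t)"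
proof -
  let ?f = "\<lambda>k i. x (Suc t) (c_out k t i)" and ?h = "\<lambda>k i. y (Suc t) (c_out k t i)"
  have "(\<Sum>i<n_out k t. \<sigma> (Suc t) (c_out k t i) * (?f k i - ?h k i)\<^sup>2)
      + s\<^sup>2 * (\<Sum>i<n_out k t. (?f k i + ?h k i)\<^sup>2 / \<sigma> (Suc t) (c_out k t i))
      + (\<Sum>e<output_dim G k t. (response k t (x t) e - response k t (y t) e)\<^sup>2)
      \<le> (\<Sum>j<n_in k t. \<sigma> t (c_in k t j) * (x t (c_in k t j) - y t (c_in k t j))\<^sup>2)
      + \<gamma> * s\<^sup>2 * ((\<Sum>j<n_in k t. (x t (c_in k t j) + y t (c_in k t j))\<^sup>2 / \<sigma> t (c_in k t j))
      + 4 * (\<Sum>m<input_dim G k t. (u k t $ m)\<^sup>2))"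
    (is "?l k \<le> ?r k") if k: "k \<in> nodes G" for k
  proof -
    interpret gramian_step "{..<n_in k t}" "{..<n_out k t}" "{..<input_dim G k t}" "{..<output_dim G k t}"
      "\<lambda>i j. matA G k t $$ (i, j)" "\<lambda>i j. matB G k t $$ (i, j)" "\<lambda>i j. matC G k t $$ (i, j)"
      "\<lambda>j. \<sigma> t (c_in k t j)" "\<lambda>i. \<sigma> (Suc t) (c_out k t i)" \<gamma>
      using k by (rule gramian_step)
    have upd: "next_state (\<lambda>j. z (c_in k t j)) (\<lambda>m. u k t $ m) i = update k t z u i" for z i
      by (simp add: next_state_def update_def)
    have f: "?f k i = (if K (Suc t) (c_out k t i) then update k t (x t) u i else 0)"
      "?h k i = (if K' (Suc t) (c_out k t i) then update k t (y t) u i else 0)"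
      if "i < n_out k t" for i
      using x y k that by (simp_all add: masked_states_def)
    show ?thesis
      using truncation_dissipation[of "\<lambda>i. K' (Suc t) (c_out k t i)" "\<lambda>i. K (Suc t) (c_out k t i)" s
          "\<lambda>j. x t (c_in k t j)" "\<lambda>m. u k t $ m" "\<lambda>j. y t (c_in k t j)"] K s c_out_coords[OF k]
      unfolding upd response_diff by (simp add: f response_def cong: sum.cong_simp)
  qed
  \<comment> \<open>New energy is collected along outgoing sites, old energy along incoming ones.
    Both cover all coordinates once, so the local inequalities add up to a global one.\<close>
  then have "(\<Sum>k\<in>nodes G. ?l k) \<le> (\<Sum>k\<in>nodes G. ?r k)" by (rule sum_mono)
  also have "(\<Sum>k\<in>nodes G. ?l k) = V (Suc t) + s\<^sup>2 * W (Suc t) + output_energy x y t"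
    unfolding sum.distrib sum_distrib_left[symmetric]
    by (simp add: V_def W_def output_energy_def
        sum_c_out[where f = "\<lambda>p. \<sigma> (Suc t) p * (x (Suc t) p - y (Suc t) p)\<^sup>2"]
        sum_c_out[where f = "\<lambda>p. (x (Suc t) p + y (Suc t) p)\<^sup>2 / \<sigma> (Suc t) p"])
  also have "(\<Sum>k\<in>nodes G. ?r k) = V t + \<gamma> * s\<^sup>2 * (W t + 4 * input_energy u t)"
    unfolding sum.distrib sum_distrib_left[symmetric]
    by (simp add: V_def W_def input_energy_def sum_c_in[where f = "\<lambda>p. \<sigma> t p * (x t p - y t p)\<^sup>2"]
        sum_c_in[where f = "\<lambda>p. (x t p + y t p)\<^sup>2 / \<sigma> t p"])
  finally show ?thesis .
qed

text \<open>The energy inequality telescopes from a zero initial state, and the remaining terminal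
  energy is nonnegative. Working with a finite horizon postpones all questions of
  convergence.\<close>

lemma single_truncation_error:
  assumes "masked_states K u x" "masked_states K' u y"
    and "\<And>t p. K' t p \<Longrightarrow> K t p"
    and "\<And>t p. p \<in> coords t \<Longrightarrow> K t p \<Longrightarrow> \<not> K' t p \<Longrightarrow> \<sigma> t p = s"
  shows "(\<Sum>t<T. output_energy x y t) \<le> 4 * \<gamma> * s\<^sup>2 * (\<Sum>t<T. input_energy u t)"
proof -
  let ?V = "\<lambda>t. \<Sum>p\<in>coords t. \<sigma> t p * (x t p - y t p)\<^sup>2"
    and ?W = "\<lambda>t. \<Sum>p\<in>coords t. (x t p + y t p)\<^sup>2 / \<sigma> t p"
  have nonneg: "0 \<le> ?V t" "0 \<le> ?W t" for t
    by (auto intro!: sum_nonneg mult_nonneg_nonneg divide_nonneg_pos less_imp_le[OF \<sigma>_bounds(1)] \<sigma>_bounds(1))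
  have "?V T + s\<^sup>2 * ?W T + (\<Sum>t<T. output_energy x y t) \<le> 4 * \<gamma> * s\<^sup>2 * (\<Sum>t<T. input_energy u t)"
  proof (induction T)
    case 0
    have "x 0 p = 0" "y 0 p = 0" if "p \<in> coords 0" for p
      using assms(1,2) that by (auto simp: masked_states_def)
    then show ?case by simp
  next
    case (Suc t)
    \<comment> \<open>For the stored energy the factor \<gamma> is relaxed to 1 so that the sum
      telescopes; the input term retains it.\<close>
    have "\<gamma> * (s\<^sup>2 * ?W t) \<le> 1 * (s\<^sup>2 * ?W t)"
      using \<gamma>_bounds nonneg by (intro mult_right_mono) auto
    then show ?case using Suc truncation_step[OF assms, of t] by (simp add: algebra_simps)
  qed
  moreover have "0 \<le> s\<^sup>2 * ?W T" using nonneg by simp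
  ultimately show ?thesis using nonneg(1)[of T] by linarith
qed

text \<open>The inverse-gramian energy contracts by \<gamma> in each step up to the input, so its
  sum over time is bounded for any mask. This is the stability estimate behind a finite
  gain.\<close>

lemma masked_state_energy:
  assumes x: "masked_states K u x"
  shows "(1 - \<gamma>) * (\<Sum>t<T. \<Sum>p\<in>coords t. (x t p)\<^sup>2 / \<sigma> t p) \<le> \<gamma> * (\<Sum>t<T. input_energy u t)"
proof -
  let ?W = "\<lambda>t. \<Sum>p\<in>coords t. (x t p)\<^sup>2 / \<sigma> t p"
  have step: "?W (Suc t) \<le> \<gamma> * (?W t + input_energy u t)" for t
  proof -
    have "(\<Sum>i<n_out k t. (x (Suc t) (c_out k t i))\<^sup>2 / \<sigma> (Suc t) (c_out k t i))
      \<le> \<gamma> * ((\<Sum>j<n_in k t. (x t (c_in k t j))\<^sup>2 / \<sigma> t (c_in k t j)) + (\<Sum>m<input_dim G k t. (u k t $ m)\<^sup>2))"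
      if k: "k \<in> nodes G" for k
    proof -
      interpret gramian_step "{..<n_in k t}" "{..<n_out k t}" "{..<input_dim G k t}" "{..<output_dim G k t}"
        "\<lambda>i j. matA G k t $$ (i, j)" "\<lambda>i j. matB G k t $$ (i, j)" "\<lambda>i j. matC G k t $$ (i, j)"
        "\<lambda>j. \<sigma> t (c_in k t j)" "\<lambda>i. \<sigma> (Suc t) (c_out k t i)" \<gamma>
        using k by (rule gramian_step)
      have "x (Suc t) (c_out k t i) = (if K (Suc t) (c_out k t i)
          then next_state (\<lambda>j. x t (c_in k t j)) (\<lambda>m. u k t $ m) i else 0)" if "i < n_out k t" for i
        using x k that by (simp add: masked_states_def next_state_def update_def)
      then show ?thesis
        using masked_reachability[of "\<lambda>i. K (Suc t) (c_out k t i)" "\<lambda>j. x t (c_in k t j)" "\<lambda>m. u k t $ m"]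
        by (simp cong: sum.cong_simp)
    qed
    then have "(\<Sum>k\<in>nodes G. \<Sum>i<n_out k t. (x (Suc t) (c_out k t i))\<^sup>2 / \<sigma> (Suc t) (c_out k t i))
      \<le> (\<Sum>k\<in>nodes G. \<gamma> * ((\<Sum>j<n_in k t. (x t (c_in k t j))\<^sup>2 / \<sigma> t (c_in k t j))
          + (\<Sum>m<input_dim G k t. (u k t $ m)\<^sup>2)))" by (rule sum_mono)
    then show ?thesis
      unfolding sum.distrib sum_distrib_left[symmetric]
      by (simp add: input_energy_def sum_c_in[where f = "\<lambda>p. (x t p)\<^sup>2 / \<sigma> t p"]
          sum_c_out[where f = "\<lambda>p. (x (Suc t) p)\<^sup>2 / \<sigma> (Suc t) p"])
  qed
  \<comment> \<open>The terminal energy has to be carried along: the next step turns it into its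
    share of the sum plus the part absorbed by contraction.\<close>
  have "?W T + (1 - \<gamma>) * (\<Sum>t<T. ?W t) \<le> \<gamma> * (\<Sum>t<T. input_energy u t)"
  proof (induction T)
    case 0
    have "x 0 p = 0" if "p \<in> coords 0" for p
      using x that by (auto simp: masked_states_def)
    then show ?case by simp
  next
    case (Suc t)
    then show ?case using step[of t] by (simp add: algebra_simps)
  qed
  moreover have "0 \<le> ?W T"
    by (auto intro!: sum_nonneg divide_nonneg_pos \<sigma>_bounds(1))
  ultimately show ?thesis by linarith
qed

text \<open>This is \<open>observability\<close> with the nonnegative next-state energy
  discarded.\<close>

lemma output_energy_le:
  "output_energy x y t \<le> (\<Sum>p\<in>coords t. \<sigma> t p * (x t p - y t p)\<^sup>2)"
proof -
  have "(\<Sum>e<output_dim G k t. (response k t (x t) e - response k t (y t) e)\<^sup>2)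
      \<le> (\<Sum>j<n_in k t. \<sigma> t (c_in k t j) * (x t (c_in k t j) - y t (c_in k t j))\<^sup>2)"
    if k: "k \<in> nodes G" for k
  proof -
    interpret gramian_step "{..<n_in k t}" "{..<n_out k t}" "{..<input_dim G k t}" "{..<output_dim G k t}"
      "\<lambda>i j. matA G k t $$ (i, j)" "\<lambda>i j. matB G k t $$ (i, j)" "\<lambda>i j. matC G k t $$ (i, j)"
      "\<lambda>j. \<sigma> t (c_in k t j)" "\<lambda>i. \<sigma> (Suc t) (c_out k t i)" \<gamma>
      using k by (rule gramian_step)
    have "0 \<le> (\<Sum>i<n_out k t. \<sigma> (Suc t) (c_out k t i)
        * (\<Sum>j<n_in k t. matA G k t $$ (i, j) * (x t (c_in k t j) - y t (c_in k t j)))\<^sup>2)"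
      using \<sigma>'_pos by (intro sum_nonneg mult_nonneg_nonneg) (auto intro: less_imp_le)
    then show ?thesis
      using observability[of "\<lambda>j. x t (c_in k t j) - y t (c_in k t j)"]
      unfolding response_diff by (simp add: response_def)
  qed
  then have "output_energy x y t \<le> (\<Sum>k\<in>nodes G. \<Sum>j<n_in k t.
      \<sigma> t (c_in k t j) * (x t (c_in k t j) - y t (c_in k t j))\<^sup>2)"
    unfolding output_energy_def by (rule sum_mono)
  then show ?thesis by (simp add: sum_c_in[where f = "\<lambda>p. \<sigma> t p * (x t p - y t p)\<^sup>2"])
qed

text \<open>The two masks may be unrelated, since both state sequences are bounded separately. Only
  finiteness of the constant matters, for the case of infinitely many removed values.\<close>

lemma crude_truncation_error:
  assumes x: "masked_states K u x" and y: "masked_states K' u y"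
  shows "(\<Sum>t<T. output_energy x y t) \<le> 4 * M\<^sup>2 * \<gamma> / (1 - \<gamma>) * (\<Sum>t<T. input_energy u t)"
proof -
  let ?W = "\<lambda>x t. \<Sum>p\<in>coords t. (x t p)\<^sup>2 / \<sigma> t p"
  let ?U = "\<Sum>t<T. input_energy u t"
  have W: "(\<Sum>t<T. ?W z t) \<le> \<gamma> * ?U / (1 - \<gamma>)" if "masked_states L u z" for z L
    using masked_state_energy[OF that, of T] \<gamma>_bounds by (simp add: pos_le_divide_eq mult.commute)
  \<comment> \<open>Multiplying by \<sigma> and using \<sigma> \<le> M exchanges the gramian weight
    for the inverse weight controlled by \<open>masked_state_energy\<close>.\<close>
  have pointwise: "\<sigma> t p * (a - b)\<^sup>2 \<le> 2 * M\<^sup>2 * (a\<^sup>2 / \<sigma> t p + b\<^sup>2 / \<sigma> t p)" if p: "p \<in> coords t" for t p a b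
  proof -
    note \<sigma> = \<sigma>_bounds[OF p]
    have "(\<sigma> t p)\<^sup>2 * (a - b)\<^sup>2 \<le> M\<^sup>2 * (2 * (a\<^sup>2 + b\<^sup>2))"
    proof (rule mult_mono)
      show "(\<sigma> t p)\<^sup>2 \<le> M\<^sup>2" using \<sigma> by (intro power_mono) auto
      show "(a - b)\<^sup>2 \<le> 2 * (a\<^sup>2 + b\<^sup>2)"
        using zero_le_power2[of "a + b"] by (simp add: power2_sum power2_diff)
    qed auto
    then show ?thesis using \<sigma>(1) by (simp add: field_simps power2_eq_square)
  qed
  have "(\<Sum>t<T. output_energy x y t) \<le> (\<Sum>t<T. \<Sum>p\<in>coords t. 2 * M\<^sup>2 * ((x t p)\<^sup>2 / \<sigma> t p + (y t p)\<^sup>2 / \<sigma> t p))"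
    by (intro sum_mono order_trans[OF output_energy_le] pointwise)
  also have "\<dots> = 2 * M\<^sup>2 * ((\<Sum>t<T. ?W x t) + (\<Sum>t<T. ?W y t))"
    by (simp add: sum_distrib_left sum.distrib distrib_left)
  also have "\<dots> \<le> 2 * M\<^sup>2 * (\<gamma> * ?U / (1 - \<gamma>) + \<gamma> * ?U / (1 - \<gamma>))"
    by (intro mult_left_mono add_mono W[OF x] W[OF y]) simp
  finally show ?thesis by (simp add: mult_ac)
qed

text \<open>The distinct values are removed one at a time; their order is irrelevant because every
  principal restriction of the gramian inequalities remains valid.\<close>

lemma truncation_error:
  assumes "finite S" "\<forall>s\<in>S. 0 \<le> s"
    and x: "masked_states (\<lambda>t p. True) u x" and y: "masked_states (\<lambda>t p. K t p \<or> \<sigma> t p \<notin> S) u y"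
  shows "sqrt (\<Sum>t<T. output_energy x y t) \<le> 2 * sqrt \<gamma> * \<Sum>S * sqrt (\<Sum>t<T. input_energy u t)"
  using assms(1,2) y
proof (induction S arbitrary: y)
  case empty
  \<comment> \<open>With nothing removed both masks are everywhere true, so the single-value
    estimate with \<open>s = 0\<close> makes the outputs agree; it takes the place of a uniqueness
    argument.\<close>
  then have "(\<Sum>t<T. output_energy x y t) \<le> 4 * \<gamma> * 0\<^sup>2 * (\<Sum>t<T. input_energy u t)"
    by (intro single_truncation_error[OF x, where s = 0]) auto
  then show ?case by simp
next
  case (insert s S)
  \<comment> \<open>The intermediate system still contains the coordinates of value
    \<open>s\<close>; exactly those not protected by \<open>K\<close> disappear between
    \<open>?z\<close> and \<open>y\<close>.\<close>
  let ?z = "masked_solution (\<lambda>t p. K t p \<or> \<sigma> t p \<notin> S) u"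
  let ?U = "\<Sum>t<T. input_energy u t"
  have z: "masked_states (\<lambda>t p. K t p \<or> \<sigma> t p \<notin> S) u ?z" by (rule masked_states_masked_solution)
  have xz: "sqrt (\<Sum>t<T. output_energy x ?z t) \<le> 2 * sqrt \<gamma> * \<Sum>S * sqrt ?U"
    using insert.prems by (intro insert.IH[OF _ z]) simp
  have "(\<Sum>t<T. output_energy ?z y t) \<le> 4 * \<gamma> * s\<^sup>2 * ?U"
    by (rule single_truncation_error[OF z insert.prems(2), where s = s]) auto
  then have "sqrt (\<Sum>t<T. output_energy ?z y t) \<le> sqrt (4 * \<gamma> * s\<^sup>2 * ?U)" by simp
  also have "\<dots> = 2 * sqrt \<gamma> * s * sqrt ?U"
    using insert.prems(1) by (simp add: real_sqrt_mult)
  finally have zy: "sqrt (\<Sum>t<T. output_energy ?z y t) \<le> 2 * sqrt \<gamma> * s * sqrt ?U" .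
  \<comment> \<open>Up to the horizon the output error is a Euclidean norm over triples of time,
    vertex and output index, so Minkowski's inequality applies.\<close>
  let ?I = "Sigma {..<T} (\<lambda>t. Sigma (nodes G) (\<lambda>k. {..<output_dim G k t}))"
  let ?d = "\<lambda>x y (t, k, e). response k t (x t) e - response k t (y t) e"
  have L2: "sqrt (\<Sum>t<T. output_energy x y t) = L2_set (?d x y) ?I" for x y
  proof -
    have "finite (nodes G)" by (simp add: nodes_def)
    then have "(\<Sum>t<T. output_energy x y t)
        = (\<Sum>t<T. \<Sum>(k, e)\<in>Sigma (nodes G) (\<lambda>k. {..<output_dim G k t}). (?d x y (t, k, e))\<^sup>2)"
      by (simp add: output_energy_def sum.Sigma)
    also have "\<dots> = (\<Sum>(t, k, e)\<in>?I. (?d x y (t, k, e))\<^sup>2)"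
      using \<open>finite (nodes G)\<close> by (subst sum.Sigma) auto
    finally show ?thesis by (simp add: L2_set_def case_prod_beta)
  qed
  have eq: "?d x y = (\<lambda>i. ?d x ?z i + ?d ?z y i)" by (auto simp: fun_eq_iff)
  have "L2_set (?d x y) ?I \<le> L2_set (?d x ?z) ?I + L2_set (?d ?z y) ?I"
    by (subst eq) (rule L2_set_triangle_ineq)
  then show ?case
    using xz zy insert.hyps unfolding L2 by (simp add: algebra_simps)
qed

end

section \<open>From trajectories to masked states\<close>

lemma mult_mat_vec_index:
  assumes "A \<in> carrier_mat m n" "v \<in> carrier_vec n" "i < m"
  shows "(A *\<^sub>v v) $ i = (\<Sum>j<n. A $$ (i, j) * v $ j)"
  using assms by (simp add: scalar_prod_eq_sum[OF assms(2)])

definition embed :: "(site \<Rightarrow> nat \<Rightarrow> nat) \<Rightarrow> (site \<Rightarrow> nat \<Rightarrow> real vec) \<Rightarrow> nat \<Rightarrow> site \<times> nat \<Rightarrow> real" where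
  "embed r x t = (\<lambda>(l, a). if a < r l t then x l t $ a else 0)"

lemma stack_at_embed:
  assumes "\<And>l. l \<in> set ls \<Longrightarrow> r l t \<le> n l t" "\<And>l. l \<in> set ls \<Longrightarrow> x l t \<in> carrier_vec (r l t)"
    and "i < total_dim r ls t"
  shows "stack_at x ls t $ i = embed r x t (coord n ls t (pick (kept n r ls t) i))"
proof -
  have "stack_at x ls t $ i = (case coord r ls t i of (l, a) \<Rightarrow> x l t $ a)"
    using assms by (intro stack_at_coord) auto
  moreover have "coord n ls t (pick (kept n r ls t) i) = coord r ls t i"
    using assms by (intro coord_pick_kept) auto
  ultimately show ?thesis
    using coord_mem[OF assms(3)] by (auto simp: embed_def)
qed

text \<open>A row of a submatrix times the reduced state equals the full row times the padded state:
  \<open>pick\<close> reindexes the kept positions, and the padding annihilates the others.\<close>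

lemma sum_stack_at_embed:
  assumes le: "\<And>l. l \<in> set ls \<Longrightarrow> r l t \<le> n l t"
    and x: "\<And>l. l \<in> set ls \<Longrightarrow> x l t \<in> carrier_vec (r l t)"
  shows "(\<Sum>i<total_dim r ls t. f (pick (kept n r ls t) i) * stack_at x ls t $ i)
    = (\<Sum>j<total_dim n ls t. f j * embed r x t (coord n ls t j))"
proof -
  let ?K = "kept n r ls t"
  have "(\<Sum>i<total_dim r ls t. f (pick ?K i) * stack_at x ls t $ i)
      = (\<Sum>i<card ?K. f (pick ?K i) * embed r x t (coord n ls t (pick ?K i)))"
    using stack_at_embed[of ls r t n x] le x card_kept_eq[of ls r t n] by (intro sum.cong) auto
  also have "\<dots> = (\<Sum>j\<in>?K. f j * embed r x t (coord n ls t j))"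
    by (rule sum.reindex_bij_betw[OF bij_betw_pick]) (use le in \<open>rule finite_kept\<close>)
  also have "\<dots> = (\<Sum>j<total_dim n ls t. f j * embed r x t (coord n ls t j))"
  proof (rule sum.mono_neutral_left)
    show "?K \<subseteq> {..<total_dim n ls t}" using le by (rule kept_subset)
    show "\<forall>j\<in>{..<total_dim n ls t} - ?K. f j * embed r x t (coord n ls t j) = 0"
    proof
      fix j assume "j \<in> {..<total_dim n ls t} - ?K"
      moreover from this have "j \<in> ?K \<longleftrightarrow> (case coord n ls t j of (l, a) \<Rightarrow> a < r l t)"
        using le by (intro kept_coord) auto
      ultimately show "f j * embed r x t (coord n ls t j) = 0"
        by (auto simp: embed_def split: prod.splits)
    qed
  qed simp
  finally show ?thesis .
qed

lemma truncation_sites [simp]: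
  "nodes (truncation G r) = nodes G" "sites (truncation G r) = sites G"
  "in_sites (truncation G r) k = in_sites G k" "out_sites (truncation G r) k = out_sites G k"
  by (simp_all add: nodes_def sites_def in_sites_def out_sites_def)

context balanced_system
begin

lemma trajectory_masked:
  assumes "trajectory G u x y"
  shows "masked_states (\<lambda>t p. True) u (\<lambda>t (l, a). x l t $ a)"
    and "k \<in> nodes G \<Longrightarrow> e < output_dim G k t \<Longrightarrow>
      y k t $ e = response k t (\<lambda>(l, a). x l t $ a) e + (matD G k t *\<^sub>v u k t) $ e"
    and "k \<in> nodes G \<Longrightarrow> dim_vec (y k t) = output_dim G k t"
proof -
  let ?X = "\<lambda>t (l, a). x l t $ a"
  have x: "x l t \<in> carrier_vec (state_dim G l t)" if "l \<in> sites G" for l t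
    using assms that by (auto simp: trajectory_def)
  have x_in: "l \<in> set (in_sites G k) \<Longrightarrow> x l t \<in> carrier_vec (state_dim G l t)"
    and x_out: "l \<in> set (out_sites G k) \<Longrightarrow> x l t \<in> carrier_vec (state_dim G l t)"
    if "k \<in> nodes G" for k l t
    using in_out_sites_subset[OF that] x by blast+
  have st: "stack_at x (in_sites G k) t \<in> carrier_vec (n_in k t)" if "k \<in> nodes G" for k t
    using x_in[OF that] by (rule stack_at_carrier)
  have u: "u k t \<in> carrier_vec (input_dim G k t)" if "k \<in> nodes G" for k t
    using assms that by (auto simp: trajectory_def is_signal_def nodes_def)
  have stack_in: "stack_at x (in_sites G k) t $ j = ?X t (c_in k t j)"
    if "k \<in> nodes G" "j < n_in k t" for k t j
    using stack_at_coord[where ls = "in_sites G k" and x = x and n = "state_dim G", of t j] x_in[OF that(1)] that(2)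
    by (simp add: case_prod_beta)
  have eqs: "stack_at x (out_sites G k) (Suc t) = matA G k t *\<^sub>v stack_at x (in_sites G k) t + matB G k t *\<^sub>v u k t"
    "y k t = matC G k t *\<^sub>v stack_at x (in_sites G k) t + matD G k t *\<^sub>v u k t" if "k \<in> nodes G" for k t
    using assms that by (simp_all add: trajectory_def)
  have "?X (Suc t) (c_out k t i) = update k t (?X t) u i" if k: "k \<in> nodes G" and i: "i < n_out k t" for k t i
  proof -
    note d = dims[OF k, where t = t]
    have "?X (Suc t) (c_out k t i) = stack_at x (out_sites G k) (Suc t) $ i"
      using stack_at_coord[where ls = "out_sites G k" and x = x and n = "state_dim G", of "Suc t" i] x_out[OF k] i
      by (simp add: case_prod_beta)
    also have "\<dots> = (matA G k t *\<^sub>v stack_at x (in_sites G k) t) $ i + (matB G k t *\<^sub>v u k t) $ i"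
      using i carrier_matD[OF d(2)] by (simp add: eqs(1)[OF k])
    finally show ?thesis
      by (simp add: update_def mult_mat_vec_index[OF d(1) st[OF k] i] mult_mat_vec_index[OF d(2) u[OF k] i]
          stack_in[OF k])
  qed
  moreover have "?X 0 p = 0" if "p \<in> coords 0" for p
    using assms that by (auto simp: trajectory_def coords_def)
  ultimately show "masked_states (\<lambda>t p. True) u ?X" by (simp add: masked_states_def)
  show "dim_vec (y k t) = output_dim G k t" if "k \<in> nodes G"
    using carrier_matD[OF dims(4)[OF that]] by (simp add: eqs(2)[OF that])
  show "y k t $ e = response k t (?X t) e + (matD G k t *\<^sub>v u k t) $ e"
    if k: "k \<in> nodes G" and e: "e < output_dim G k t"
  proof -
    note d = dims[OF k, where t = t]
    have "y k t $ e = (matC G k t *\<^sub>v stack_at x (in_sites G k) t) $ e + (matD G k t *\<^sub>v u k t) $ e"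
      using e carrier_matD[OF d(4)] by (simp add: eqs(2)[OF k])
    then show ?thesis
      by (simp add: response_def mult_mat_vec_index[OF d(3) st[OF k] e] stack_in[OF k])
  qed
qed

text \<open>Deleting columns amounts to padding the state with zeros, deleting rows to resetting the
  update; hence a truncated trajectory becomes a masked solution for the full matrices.\<close>

lemma truncation_trajectory_masked:
  assumes r: "\<forall>l\<in>sites G. \<forall>t. r l t \<le> state_dim G l t" and traj: "trajectory (truncation G r) u x y"
  shows "masked_states (\<lambda>t (l, a). a < r l t) u (embed r x)"
    and "k \<in> nodes G \<Longrightarrow> e < output_dim G k t \<Longrightarrow>
      y k t $ e = response k t (embed r x t) e + (matD G k t *\<^sub>v u k t) $ e"
    and "k \<in> nodes G \<Longrightarrow> dim_vec (y k t) = output_dim G k t"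
proof -
  let ?K_in = "\<lambda>k t. kept (state_dim G) r (in_sites G k) t"
  let ?K_out = "\<lambda>k t. kept (state_dim G) r (out_sites G k) (Suc t)"
  let ?A = "\<lambda>k t. submatrix (matA G k t) (?K_out k t) (?K_in k t)"
  let ?B = "\<lambda>k t. submatrix (matB G k t) (?K_out k t) UNIV"
  let ?C = "\<lambda>k t. submatrix (matC G k t) UNIV (?K_in k t)"
  have r_in: "l \<in> set (in_sites G k) \<Longrightarrow> r l t \<le> state_dim G l t"
    and r_out: "l \<in> set (out_sites G k) \<Longrightarrow> r l t \<le> state_dim G l t"
    if "k \<in> nodes G" for k l t
    using in_out_sites_subset[OF that] r by blast+
  have x: "x l t \<in> carrier_vec (r l t)" if "l \<in> sites G" for l t
    using traj that by (auto simp: trajectory_def)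
  have x_in: "l \<in> set (in_sites G k) \<Longrightarrow> x l t \<in> carrier_vec (r l t)"
    and x_out: "l \<in> set (out_sites G k) \<Longrightarrow> x l t \<in> carrier_vec (r l t)"
    if "k \<in> nodes G" for k l t
    using in_out_sites_subset[OF that] x by blast+
  have st: "stack_at x (in_sites G k) t \<in> carrier_vec (total_dim r (in_sites G k) t)" if "k \<in> nodes G" for k t
    using x_in[OF that] by (rule stack_at_carrier)
  have u: "u k t \<in> carrier_vec (input_dim G k t)" if "k \<in> nodes G" for k t
    using traj that by (auto simp: trajectory_def is_signal_def nodes_def)
  have eqs: "stack_at x (out_sites G k) (Suc t) = ?A k t *\<^sub>v stack_at x (in_sites G k) t + ?B k t *\<^sub>v u k t"
    "y k t = ?C k t *\<^sub>v stack_at x (in_sites G k) t + matD G k t *\<^sub>v u k t" if "k \<in> nodes G" for k t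
    using traj that by (simp_all add: trajectory_def)
  have rdims: "?A k t \<in> carrier_mat (total_dim r (out_sites G k) (Suc t)) (total_dim r (in_sites G k) t)"
    "?B k t \<in> carrier_mat (total_dim r (out_sites G k) (Suc t)) (input_dim G k t)"
    "?C k t \<in> carrier_mat (output_dim G k t) (total_dim r (in_sites G k) t)" if "k \<in> nodes G" for k t
    using truncation_well_dimensioned[OF well_dimensioned r] that by (auto simp: well_dimensioned_def)
  have index: "?A k t $$ (i, j) = matA G k t $$ (pick (?K_out k t) i, pick (?K_in k t) j)"
    if "k \<in> nodes G" "i < total_dim r (out_sites G k) (Suc t)" "j < total_dim r (in_sites G k) t" for k t i j
    using submatrix_index[of i "matA G k t" "?K_out k t" j "?K_in k t"] carrier_matD[OF rdims(1)[OF that(1), of t]] that(2,3)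
    by (simp add: dim_submatrix)
  have indexB: "?B k t $$ (i, j) = matB G k t $$ (pick (?K_out k t) i, j)"
    if "k \<in> nodes G" "i < total_dim r (out_sites G k) (Suc t)" "j < input_dim G k t" for k t i j
    using submatrix_index[of i "matB G k t" "?K_out k t" j UNIV] carrier_matD[OF rdims(2)[OF that(1), of t]] that(2,3)
    by (simp add: dim_submatrix pick_UNIV)
  have indexC: "?C k t $$ (i, j) = matC G k t $$ (i, pick (?K_in k t) j)"
    if "k \<in> nodes G" "i < output_dim G k t" "j < total_dim r (in_sites G k) t" for k t i j
    using submatrix_index[of i "matC G k t" UNIV j "?K_in k t"] carrier_matD[OF rdims(3)[OF that(1), of t]] that(2,3)
    by (simp add: dim_submatrix pick_UNIV)
  have mask: "i \<in> ?K_out k t \<longleftrightarrow> (case c_out k t i of (l, a) \<Rightarrow> a < r l (Suc t))"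
    if "k \<in> nodes G" "i < n_out k t" for k t i
    using r_out[OF that(1)] that(2) by (intro kept_coord)
  have sum_in: "(\<Sum>j<total_dim r (in_sites G k) t. f (pick (?K_in k t) j) * stack_at x (in_sites G k) t $ j)
      = (\<Sum>j<n_in k t. f j * embed r x t (c_in k t j))" if "k \<in> nodes G" for k t f
    using r_in[OF that] x_in[OF that] by (intro sum_stack_at_embed)
  have "embed r x (Suc t) (c_out k t i) = (if case c_out k t i of (l, a) \<Rightarrow> a < r l (Suc t)
      then update k t (embed r x t) u i else 0)"
    if k: "k \<in> nodes G" and i: "i < n_out k t" for k t i
  proof (cases "i \<in> ?K_out k t")
    case False
    then show ?thesis
      using mask[OF k i] by (auto simp: embed_def split: prod.splits)
  next
    case True
    let ?m = "total_dim r (out_sites G k) (Suc t)"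
    have "bij_betw (pick (?K_out k t)) {..<?m} (?K_out k t)"
      using bij_betw_pick[OF finite_kept, of "out_sites G k" r "Suc t" "state_dim G"]
        card_kept_eq[of "out_sites G k" r "Suc t" "state_dim G"] r_out[OF k] by simp
    then have "i \<in> pick (?K_out k t) ` {..<?m}" using True by (simp add: bij_betw_def)
    \<comment> \<open>A kept row of the full update is row \<open>i'\<close> of the truncated
      one.\<close>
    then obtain i' where i': "i' < ?m" "pick (?K_out k t) i' = i" by (metis imageE lessThan_iff)
    have "embed r x (Suc t) (c_out k t i) = stack_at x (out_sites G k) (Suc t) $ i'"
      using stack_at_embed[of "out_sites G k" r "Suc t" "state_dim G" x i'] r_out[OF k] x_out[OF k] i' by simp
    also have "\<dots> = (?A k t *\<^sub>v stack_at x (in_sites G k) t) $ i' + (?B k t *\<^sub>v u k t) $ i'"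
      using i' carrier_matD[OF rdims(2)[OF k, of t]] by (simp add: eqs(1)[OF k])
    also have "(?A k t *\<^sub>v stack_at x (in_sites G k) t) $ i'
        = (\<Sum>j<total_dim r (in_sites G k) t. matA G k t $$ (i, pick (?K_in k t) j) * stack_at x (in_sites G k) t $ j)"
      using i' by (simp add: mult_mat_vec_index[OF rdims(1)[OF k] st[OF k] i'(1)] index[OF k])
    also have "\<dots> = (\<Sum>j<n_in k t. matA G k t $$ (i, j) * embed r x t (c_in k t j))"
      using sum_in[OF k] .
    also have "(?B k t *\<^sub>v u k t) $ i' = (\<Sum>m<input_dim G k t. matB G k t $$ (i, m) * u k t $ m)"
      using i' by (simp add: mult_mat_vec_index[OF rdims(2)[OF k] u[OF k] i'(1)] indexB[OF k])
    finally show ?thesis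
      using True mask[OF k i] by (simp add: update_def case_prod_beta)
  qed
  moreover have "embed r x 0 p = 0" if "p \<in> coords 0" for p
    using traj that by (auto simp: trajectory_def coords_def embed_def)
  ultimately show "masked_states (\<lambda>t (l, a). a < r l t) u (embed r x)" by (simp add: masked_states_def)
  show "dim_vec (y k t) = output_dim G k t" if "k \<in> nodes G"
    using carrier_matD[OF dims(4)[OF that]] by (simp add: eqs(2)[OF that])
  show "y k t $ e = response k t (embed r x t) e + (matD G k t *\<^sub>v u k t) $ e"
    if k: "k \<in> nodes G" and e: "e < output_dim G k t"
  proof -
    have "y k t $ e = (?C k t *\<^sub>v stack_at x (in_sites G k) t) $ e + (matD G k t *\<^sub>v u k t) $ e"
      using e carrier_matD[OF dims(4)[OF k, of t]] by (simp add: eqs(2)[OF k])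
    also have "(?C k t *\<^sub>v stack_at x (in_sites G k) t) $ e
        = (\<Sum>j<total_dim r (in_sites G k) t. matC G k t $$ (e, pick (?K_in k t) j) * stack_at x (in_sites G k) t $ j)"
      using e by (simp add: mult_mat_vec_index[OF rdims(3)[OF k] st[OF k] e] indexC[OF k])
    also have "\<dots> = response k t (embed r x t) e"
      unfolding response_def using sum_in[OF k] .
    finally show ?thesis .
  qed
qed

lemma error_map_masked:
  assumes r: "\<forall>l\<in>sites G. \<forall>t. r l t \<le> state_dim G l t"
    and ue: "(u, e) \<in> error_map G (truncation G r)"
  obtains x y where "masked_states (\<lambda>t p. True) u x" "masked_states (\<lambda>t (l, a). a < r l t) u y"
    "\<And>t. (\<Sum>k\<in>nodes G. e k t \<bullet> e k t) = output_energy x y t"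
    "\<And>t. (\<Sum>k\<in>nodes G. u k t \<bullet> u k t) = input_energy u t"
proof -
  obtain x xr y z where x: "trajectory G u x y" and xr: "trajectory (truncation G r) u xr z"
    and e: "e = (\<lambda>k t. y k t - z k t)"
    using ue by (auto simp: error_map_def io_map_def)
  let ?X = "\<lambda>t (l, a). x l t $ a"
  note G = trajectory_masked[OF x] and Gr = truncation_trajectory_masked[OF r xr]
  have "e k t \<bullet> e k t = (\<Sum>i<output_dim G k t. (response k t (?X t) i - response k t (embed r xr t) i)\<^sup>2)"
    if k: "k \<in> nodes G" for k t
  proof -
    have "e k t \<in> carrier_vec (output_dim G k t)"
      using Gr(3)[OF k] by (intro carrier_vecI) (simp add: e)
    moreover have "e k t $ i = response k t (?X t) i - response k t (embed r xr t) i"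
      if "i < output_dim G k t" for i
      using G(2)[OF k that] Gr(2,3)[OF k] that by (simp add: e)
    ultimately show ?thesis by (simp add: scalar_prod_eq_sum power2_eq_square)
  qed
  moreover have "u k t \<bullet> u k t = (\<Sum>m<input_dim G k t. (u k t $ m)\<^sup>2)" if "k \<in> nodes G" for k t
  proof -
    have "u k t \<in> carrier_vec (input_dim G k t)"
      using x that by (auto simp: trajectory_def is_signal_def nodes_def)
    then show ?thesis by (simp add: scalar_prod_eq_sum power2_eq_square)
  qed
  ultimately show ?thesis
    by (intro that[OF G(1) Gr(1)]) (simp_all add: output_energy_def input_energy_def)
qed

end

section \<open>The error bound\<close>

lemma scalar_prod_self_nonneg: "0 \<le> v \<bullet> v" for v :: "real vec"
  by (simp add: scalar_prod_def sum_nonneg)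

lemma ennreal_divide_le:
  fixes a b :: ennreal
  assumes "a \<le> c * b" "c < \<infinity>"
  shows "a / b \<le> c"
proof (cases "b = 0 \<or> b = \<infinity>")
  \<comment> \<open>In \<open>ennreal\<close> both \<open>0 / 0\<close> and division by infinity
    give 0, so the degenerate denominators are harmless.\<close>
  case True
  then show ?thesis using assms by (auto simp: divide_ennreal_def)
next
  case False
  then have "a / b \<le> c * b / b" using assms by (intro divide_right_mono_ennreal)
  also have "c * b / b = c" using False by (intro mult_divide_eq_ennreal) auto
  finally show ?thesis .
qed

text \<open>Bounds with a constant independent of the horizon pass to the limit. They also yield
  square summability of the output, so its norm does not fall into the infinite branch of
  \<open>ell2_norm\<close>.\<close>

lemma io_norm_le:
  assumes \<kappa>: "0 \<le> \<kappa>"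
    and gain: "\<And>u y T. (u, y) \<in> R \<Longrightarrow>
      sqrt (\<Sum>t<T. \<Sum>k\<in>{1..N}. y k t \<bullet> y k t) \<le> \<kappa> * sqrt (\<Sum>t<T. \<Sum>k\<in>{1..N}. u k t \<bullet> u k t)"
  shows "io_norm N R \<le> ennreal \<kappa>"
  unfolding io_norm_def
proof (rule SUP_least, clarify)
  fix u y assume uy: "(u, y) \<in> R" and u: "in_ell2 N u"
  let ?f = "\<lambda>w :: signal. \<lambda>(t, k). w k t \<bullet> w k t" and ?A = "UNIV \<times> {1..N}"
  have nonneg: "0 \<le> ?f w p" for w p by (simp add: case_prod_beta scalar_prod_self_nonneg)
  have bound: "sum (?f y) F \<le> \<kappa>\<^sup>2 * infsum (?f u) ?A" if F: "finite F" "F \<subseteq> ?A" for F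
  proof -
    have "finite (fst ` F)" using F by simp
    \<comment> \<open>Unordered sums are suprema over finite index sets, and each such set lies
      within some finite horizon.\<close>
    then obtain T where T: "fst ` F \<subseteq> {..<T}" using finite_nat_iff_bounded by blast
    have "sum (?f y) F \<le> sum (?f y) ({..<T} \<times> {1..N})"
    proof (rule sum_mono2)
      show "F \<subseteq> {..<T} \<times> {1..N}" using F T by fastforce
    qed (use nonneg in auto)
    also have "\<dots> = (\<Sum>t<T. \<Sum>k\<in>{1..N}. y k t \<bullet> y k t)" by (simp add: sum.cartesian_product)
    also have "\<dots> \<le> \<kappa>\<^sup>2 * (\<Sum>t<T. \<Sum>k\<in>{1..N}. u k t \<bullet> u k t)"
    proof -
      have "0 \<le> (\<Sum>t<T. \<Sum>k\<in>{1..N}. u k t \<bullet> u k t)" "0 \<le> (\<Sum>t<T. \<Sum>k\<in>{1..N}. y k t \<bullet> y k t)"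
        by (intro sum_nonneg scalar_prod_self_nonneg)+
      then show ?thesis
        using power_mono[OF gain[OF uy, of T], of 2] by (simp add: power_mult_distrib)
    qed
    also have "(\<Sum>t<T. \<Sum>k\<in>{1..N}. u k t \<bullet> u k t) = sum (?f u) ({..<T} \<times> {1..N})"
      by (simp add: sum.cartesian_product)
    also have "\<kappa>\<^sup>2 * \<dots> \<le> \<kappa>\<^sup>2 * infsum (?f u) ?A"
      using u nonneg unfolding in_ell2_def by (intro mult_left_mono finite_sum_le_infsum) auto
    finally show ?thesis .
  qed
  have y: "?f y summable_on ?A"
    using bound nonneg by (intro nonneg_bdd_above_summable_on) (auto simp: bdd_above_def)
  then have "infsum (?f y) ?A \<le> \<kappa>\<^sup>2 * infsum (?f u) ?A"
    using bound by (rule infsum_le_finite_sums)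
  then have "sqrt (infsum (?f y) ?A) \<le> sqrt (\<kappa>\<^sup>2 * infsum (?f u) ?A)" by simp
  also have "\<dots> = \<kappa> * sqrt (infsum (?f u) ?A)" using \<kappa> by (simp add: real_sqrt_mult)
  finally have "ell2_norm N y \<le> ennreal \<kappa> * ell2_norm N u"
    using u y \<kappa> infsum_nonneg[of ?A "?f u"] nonneg
    by (simp add: ell2_norm_def in_ell2_def ennreal_mult[symmetric] ennreal_leI)
  then show "ell2_norm N y / ell2_norm N u \<le> ennreal \<kappa>"
    by (rule ennreal_divide_le) simp
qed

lemma unit_vec_mult_diagonal:
  fixes S :: "real mat"
  assumes "S \<in> carrier_mat n n" "diagonal_mat S" "a < n"
  shows "S *\<^sub>v unit_vec n a = S $$ (a, a) \<cdot>\<^sub>v unit_vec n a"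
proof (rule eq_vecI)
  fix i assume "i < dim_vec (S $$ (a, a) \<cdot>\<^sub>v unit_vec n a)"
  then have i: "i < n" by simp
  then have "(S *\<^sub>v unit_vec n a) $ i = (\<Sum>j<n. S $$ (i, j) * unit_vec n a $ j)"
    using assms(1) by (intro mult_mat_vec_index) auto
  also have "\<dots> = (\<Sum>j<n. if j = a then S $$ (i, a) else 0)"
    using assms(3) by (intro sum.cong) (auto simp: unit_vec_def)
  also have "\<dots> = S $$ (i, a)" using assms(3) by simp
  finally show "(S *\<^sub>v unit_vec n a) $ i = (S $$ (a, a) \<cdot>\<^sub>v unit_vec n a) $ i"
    using assms i by (auto simp: diagonal_mat_def unit_vec_def)
qed (use assms in auto)

text \<open>Unit vectors test both conditions: definiteness gives the lower bound on a diagonal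
  entry, the operator norm bound the upper one.\<close>

lemma balanced_gramians_balanced_system:
  assumes G: "well_dimensioned G" and bal: "balanced_gramians G \<Sigma>"
  obtains \<beta> M where "balanced_system G \<Sigma> \<beta> M"
proof -
  have gram: "\<Sigma> l t \<in> carrier_mat (state_dim G l t) (state_dim G l t)" "diagonal_mat (\<Sigma> l t)"
    if "l \<in> sites G" for l t
    using bal that by (auto simp: balanced_gramians_def)
  obtain \<beta> where \<beta>: "0 < \<beta>" "\<forall>l\<in>sites G. \<forall>t. \<beta> \<cdot>\<^sub>m 1\<^sub>m (state_dim G l t) \<prec>\<^sub>L \<Sigma> l t"
    and lyap: "\<forall>k\<in>nodes G. \<forall>t.
      matA G k t * diag_at \<Sigma> (in_sites G k) t * (matA G k t)\<^sup>T - diag_at \<Sigma> (out_sites G k) (Suc t)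
        + matB G k t * (matB G k t)\<^sup>T
      \<prec>\<^sub>L (- \<beta>) \<cdot>\<^sub>m 1\<^sub>m (total_dim (state_dim G) (out_sites G k) (Suc t)) \<and>
      (matA G k t)\<^sup>T * diag_at \<Sigma> (out_sites G k) (Suc t) * matA G k t - diag_at \<Sigma> (in_sites G k) t
        + (matC G k t)\<^sup>T * matC G k t
      \<prec>\<^sub>L (- \<beta>) \<cdot>\<^sub>m 1\<^sub>m (total_dim (state_dim G) (in_sites G k) t)"
    using bal unfolding balanced_gramians_def Let_def Suc_eq_plus1[symmetric] by blast
  obtain M where M: "\<And>l t v. l \<in> sites G \<Longrightarrow> v \<in> carrier_vec (dim_col (\<Sigma> l t)) \<Longrightarrow>
      vec_norm2 (\<Sigma> l t *\<^sub>v v) \<le> M * vec_norm2 v"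
    using bal unfolding balanced_gramians_def uniformly_bounded_def by blast
  have "\<beta> < \<Sigma> l t $$ (a, a)" "\<Sigma> l t $$ (a, a) \<le> M" if l: "l \<in> sites G" and a: "a < state_dim G l t" for l t a
  proof -
    let ?n = "state_dim G l t"
    let ?e = "unit_vec ?n a :: real vec"
    note \<Sigma>e = unit_vec_mult_diagonal[OF gram[OF l] a]
    have e: "?e \<in> carrier_vec ?n" "?e \<noteq> 0\<^sub>v ?n" "?e \<bullet> ?e = 1"
      using a by (auto simp: unit_vec_nonzero scalar_prod_left_unit)
    have "0 < ?e \<bullet> ((\<Sigma> l t - \<beta> \<cdot>\<^sub>m 1\<^sub>m ?n) *\<^sub>v ?e)"
      using \<beta>(2) l e gram(1)[OF l, of t] by (fastforce simp: mat_less_def)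
    also have "(\<Sigma> l t - \<beta> \<cdot>\<^sub>m 1\<^sub>m ?n) *\<^sub>v ?e = \<Sigma> l t *\<^sub>v ?e - \<beta> \<cdot>\<^sub>v ?e"
      using gram(1)[OF l, of t] e(1) unit_vec_mult_diagonal[of "\<beta> \<cdot>\<^sub>m 1\<^sub>m ?n" ?n a] a
      by (simp add: minus_mult_distrib_mat_vec[of _ ?n ?n] diagonal_mat_def)
    also have "?e \<bullet> (\<Sigma> l t *\<^sub>v ?e - \<beta> \<cdot>\<^sub>v ?e) = \<Sigma> l t $$ (a, a) - \<beta>"
      unfolding \<Sigma>e using e by (simp add: scalar_prod_minus_distrib[of _ ?n])
    finally show "\<beta> < \<Sigma> l t $$ (a, a)" by simp
    have "vec_norm2 (\<Sigma> l t *\<^sub>v ?e) \<le> M * vec_norm2 ?e"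
      using gram(1)[OF l, of t] by (intro M[OF l]) auto
    then have "\<bar>\<Sigma> l t $$ (a, a)\<bar> \<le> M"
      unfolding \<Sigma>e vec_norm2_def using e by (simp add: power2_eq_square[symmetric])
    then show "\<Sigma> l t $$ (a, a) \<le> M" by simp
  qed
  then have "balanced_system G \<Sigma> \<beta> M"
    using G \<beta>(1) gram lyap by (intro balanced_system.intro) auto
  then show ?thesis by (rule that)
qed

text \<open>The hypothesis \<open>nonempty\<close> excludes the trivial truncation, for which both
  sides are zero and the strict inequality fails.\<close>

theorem theorem2:
  fixes G :: dist_system
    and \<Sigma> \<Gamma> \<Omega> :: "site \<Rightarrow> nat \<Rightarrow> real mat"
    and r :: "site \<Rightarrow> nat \<Rightarrow> nat"
  assumes "distributed_system G"
    and "balanced_gramians G \<Sigma>"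
    and "\<forall>l\<in>sites G. \<forall>t. r l t \<le> state_dim G l t"
    and "\<forall>l\<in>sites G. \<forall>t.
           \<Gamma> l t \<in> carrier_mat (r l t) (r l t) \<and>
           \<Omega> l t \<in> carrier_mat (state_dim G l t - r l t) (state_dim G l t - r l t) \<and>
           \<Sigma> l t = diag_block_mat [\<Gamma> l t, \<Omega> l t]"
    and nonempty: "block_diag_index G \<Omega> \<noteq> {}"
  shows "io_norm (num_nodes G) (error_map G (truncation G r))
           < 2 * distinct_diag_sum (block_diag_index G \<Omega>) (block_diag \<Omega>)"
proof -
  have wd: "well_dimensioned G" using assms(1) by (simp add: distributed_system_def)
  obtain \<beta> M where "balanced_system G \<Sigma> \<beta> M"
    using balanced_gramians_balanced_system[OF wd assms(2)] .
  then interpret balanced_system G \<Sigma> \<beta> M .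
  note r = assms(3)
  define S where "S = (\<lambda>i. block_diag \<Omega> i i) ` block_diag_index G \<Omega>"
  have \<Omega>: "dim_row (\<Omega> l t) = state_dim G l t - r l t" and
    diag: "a < state_dim G l t - r l t \<Longrightarrow> \<Omega> l t $$ (a, a) = \<sigma> t (l, r l t + a)"
    if l: "l \<in> sites G" for l t a
  proof -
    have c: "\<Gamma> l t \<in> carrier_mat (r l t) (r l t)"
      "\<Omega> l t \<in> carrier_mat (state_dim G l t - r l t) (state_dim G l t - r l t)"
      and eq: "\<Sigma> l t = diag_block_mat [\<Gamma> l t, \<Omega> l t]" using assms(4) l by blast+
    show "dim_row (\<Omega> l t) = state_dim G l t - r l t" using c by simp
    show "\<Omega> l t $$ (a, a) = \<sigma> t (l, r l t + a)" if "a < state_dim G l t - r l t"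
      using that carrier_matD[OF c(1)] carrier_matD[OF c(2)] unfolding \<sigma>_def by (simp add: eq Let_def)
  qed
  \<comment> \<open>Offset \<open>a\<close> inside a removed block is offset
    \<open>r l t + a\<close> of the full gramian, which translates the entries of
    \<open>\<Omega>\<close> into values of \<open>\<sigma>\<close>.\<close>
  have S_eq: "S = {\<sigma> t (l, a) | l t a. l \<in> sites G \<and> r l t \<le> a \<and> a < state_dim G l t}"
  proof (intro equalityI subsetI)
    fix s assume "s \<in> S"
    then obtain l t a where la: "l \<in> sites G" "a < state_dim G l t - r l t" "s = \<Omega> l t $$ (a, a)"
      using \<Omega> by (auto simp: S_def block_diag_index_def block_diag_def)
    then show "s \<in> {\<sigma> t (l, a) | l t a. l \<in> sites G \<and> r l t \<le> a \<and> a < state_dim G l t}"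
      using diag[OF la(1,2)] by (intro CollectI exI[of _ l] exI[of _ t] exI[of _ "r l t + a"]) auto
  next
    fix s assume "s \<in> {\<sigma> t (l, a) | l t a. l \<in> sites G \<and> r l t \<le> a \<and> a < state_dim G l t}"
    then obtain l t a where la: "s = \<sigma> t (l, a)" "l \<in> sites G" "r l t \<le> a" "a < state_dim G l t" by blast
    then have "(l, t, a - r l t) \<in> block_diag_index G \<Omega>" "s = block_diag \<Omega> (l, t, a - r l t) (l, t, a - r l t)"
      using \<Omega>[OF la(2), of t] diag[OF la(2), of "a - r l t" t] by (auto simp: block_diag_index_def block_diag_def)
    then show "s \<in> S" by (auto simp: S_def)
  qed
  have S_ge: "\<beta> \<le> s" if "s \<in> S" for s
    using that by (auto simp: S_eq coords_def intro!: \<sigma>_bounds(2))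
  have S_mem: "\<sigma> t (l, a) \<in> S" if "(l, a) \<in> coords t" "\<not> a < r l t" for t l a
    unfolding S_eq using that by (intro CollectI exI[of _ l] exI[of _ t] exI[of _ a]) (simp add: coords_def)
  have nodes: "nodes G = {1..num_nodes G}" by (simp add: nodes_def)
  show ?thesis
  proof (cases "finite S")
    case True
    let ?\<kappa> = "2 * sqrt \<gamma> * \<Sum>S"
    have pos: "0 < \<Sum>S"
      using True nonempty S_ge \<beta>_pos by (intro sum_pos) (force simp: S_def)+
    have "io_norm (num_nodes G) (error_map G (truncation G r)) \<le> ennreal ?\<kappa>"
    proof (rule io_norm_le)
      show "0 \<le> ?\<kappa>" using pos \<gamma>_bounds by simp
      fix u e T assume "(u, e) \<in> error_map G (truncation G r)"
      then obtain x y where x: "masked_states (\<lambda>t p. True) u x"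
        and y: "masked_states (\<lambda>t (l, a). a < r l t) u y"
        and en: "\<And>t. (\<Sum>k\<in>nodes G. e k t \<bullet> e k t) = output_energy x y t"
          "\<And>t. (\<Sum>k\<in>nodes G. u k t \<bullet> u k t) = input_energy u t"
        using error_map_masked[OF r] by blast
      \<comment> \<open>All removed values lie in \<open>S\<close>, so the mask is unchanged on
        coordinates. The disjunct \<open>a < r l t\<close> protects kept coordinates that share a
        value with a removed one.\<close>
      have "masked_states (\<lambda>t p. (\<lambda>t (l, a). a < r l t) t p \<or> \<sigma> t p \<notin> S) u y"
        by (rule masked_states_cong[OF y]) (use S_mem in auto)
      then show "sqrt (\<Sum>t<T. \<Sum>k\<in>{1..num_nodes G}. e k t \<bullet> e k t)
          \<le> ?\<kappa> * sqrt (\<Sum>t<T. \<Sum>k\<in>{1..num_nodes G}. u k t \<bullet> u k t)"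
        unfolding nodes[symmetric] en
        using S_ge \<beta>_pos by (intro truncation_error[OF True _ x]) force+
    qed
    \<comment> \<open>Here \<gamma> < 1 gives strictness; the sum must be positive, which rests on
      \<open>nonempty\<close> and the lower bound \<open>\<beta>\<close>.\<close>
    also have "ennreal ?\<kappa> < ennreal (2 * \<Sum>S)"
      using pos \<gamma>_bounds by (intro ennreal_lessI) auto
    also have "ennreal (2 * \<Sum>S) = 2 * distinct_diag_sum (block_diag_index G \<Omega>) (block_diag \<Omega>)"
    proof -
      have "distinct_diag_sum (block_diag_index G \<Omega>) (block_diag \<Omega>) = (\<Sum>s\<in>S. ennreal s)"
        using True by (simp add: distinct_diag_sum_def S_def)
      also have "\<dots> = ennreal (\<Sum>S)"
        using S_ge \<beta>_pos by (intro sum_ennreal) force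
      finally show ?thesis using pos by (simp add: ennreal_mult)
    qed
    finally show ?thesis .
  next
    case False
    let ?\<kappa> = "sqrt (4 * M\<^sup>2 * \<gamma> / (1 - \<gamma>))"
    have "io_norm (num_nodes G) (error_map G (truncation G r)) \<le> ennreal ?\<kappa>"
    proof (rule io_norm_le)
      show "0 \<le> ?\<kappa>" using \<gamma>_bounds by simp
      fix u e T assume "(u, e) \<in> error_map G (truncation G r)"
      then obtain x y where xy: "masked_states (\<lambda>t p. True) u x" "masked_states (\<lambda>t (l, a). a < r l t) u y"
        and en: "\<And>t. (\<Sum>k\<in>nodes G. e k t \<bullet> e k t) = output_energy x y t"
          "\<And>t. (\<Sum>k\<in>nodes G. u k t \<bullet> u k t) = input_energy u t"
        using error_map_masked[OF r] by blast
      show "sqrt (\<Sum>t<T. \<Sum>k\<in>{1..num_nodes G}. e k t \<bullet> e k t)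
          \<le> ?\<kappa> * sqrt (\<Sum>t<T. \<Sum>k\<in>{1..num_nodes G}. u k t \<bullet> u k t)"
        unfolding nodes[symmetric] en real_sqrt_mult[symmetric]
        using crude_truncation_error[OF xy] by simp
    qed
    also have "ennreal ?\<kappa> < \<infinity>" by simp
    also have "\<infinity> = 2 * distinct_diag_sum (block_diag_index G \<Omega>) (block_diag \<Omega>)"
    proof -
      have "distinct_diag_sum (block_diag_index G \<Omega>) (block_diag \<Omega>) = \<infinity>"
        unfolding distinct_diag_sum_def S_def[symmetric]
        using S_ge \<beta>_pos False by (intro infsum_superconst_infinite_ennreal[of _ "ennreal \<beta>"]) (auto intro: ennreal_leI)
      then show ?thesis by (simp add: ennreal_mult_top)
    qed
    finally show ?thesis .
  qed
qed

end
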